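(* Let $X$ be a real Hilbert space, let $f,g\colon X\to\,]-\infty,+\infty]$ be proper, lower semicontinuous, $\alpha$-convex and $\beta$-convex, respectively, and let $h\colon X\to\mathbb R$ be differentiable and convex with $\nabla h$ Lipschitz continuous with constant $1/\sigma$ ($\sigma>0$). Let $\gamma,\delta,\eta>0$ and suppose that either (a) $\alpha+\beta=0$, $1+2\gamma\alpha>0$, $\delta=\frac{\gamma}{1+2\gamma\alpha}$, and $\eta^*:=2+2\gamma\alpha-\frac{\gamma}{2\sigma}>0$; or (b) $\alpha+\beta>0$ and $\eta^*:=\frac{4\gamma\delta(1+\gamma\alpha)(1+\delta\beta)-(\gamma+\delta)^2}{2\gamma\delta^2(\alpha+\beta)}-\frac{\gamma}{2\sigma}>0$. Set $\lambda:=1+\frac\delta\gamma$, $S:=(1-\lambda)\mathrm{Id}+\lambda\operatorname{Prox}_{\gamma f}-\delta\nabla h\operatorname{Prox}_{\gamma f}$, and $$T_{f,g,h}:=\mathrm{Id}-\eta\operatorname{Prox}_{\gamma f}+\eta\operatorname{Prox}_{\delta g}S.$$ Let $x_0\in X$ and $x_{n+1}:=T_{f,g,h}x_n$. Then: (i) $T_{f,g,h}$ is single-valued, has full domain, and is conically $\frac{\eta}{\eta^*}$-averaged. (ii) If $\operatorname{zer}(\widehat\partial f+\widehat\partial g+\nabla h)\neq\varnothing$ and $\eta<\eta^*$, then $\|x_n-T_{f,g,h}x_n\|=o(1/\sqrt n)$, $(x_n)$ converges weakly to some $x^*\in\operatorname{Fix}T_{f,g,h}$ with $\operatorname{Prox}_{\gamma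 f}x^*\in\operatorname{zer}(\widehat\partial f+\widehat\partial g+\nabla h)\subseteq\operatorname{argmin}(f+g+h)$, $(\nabla h\operatorname{Prox}_{\gamma f}x_n)$ converges strongly to $\nabla h\operatorname{Prox}_{\gamma f}x^*$, and $\nabla h(\operatorname{zer}(\widehat\partial f+\widehat\partial g+\nabla h))=\{\nabla h\operatorname{Prox}_{\gamma f}x^*\}$. Moreover, under (a), $(\operatorname{Prox}_{\gamma f}x_n)$ and $(\operatorname{Prox}_{\delta g}Sx_n)$ converge weakly to $\operatorname{Prox}_{\gamma f}x^*=\operatorname{Prox}_{\delta g}Sx^*$; under (b), they converge strongly to $\operatorname{Prox}_{\gamma f}x^*=\operatorname{Prox}_{\delta g}Sx^*$ and $\operatorname{zer}(\widehat\partial f+\widehat\partial g+\nabla h)=\{\operatorname{Prox}_{\gamma f}x^*\}$.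
   Context: A function $f\colon X\to\,]-\infty,+\infty]$ is proper if $\operatorname{dom}f:=\{x:f(x)<+\infty\}\ne\varnothing$; it is $\alpha$-convex ($\alpha\in\mathbb R$) if $f((1-\kappa)x+\kappa y)+\frac\alpha2\kappa(1-\kappa)\|x-y\|^2\le(1-\kappa)f(x)+\kappa f(y)$ for all $x,y\in\operatorname{dom}f$, $\kappa\in(0,1)$. The Fréchet subdifferential is $\widehat\partial f(x):=\{u\in X:\liminf_{z\to x}\frac{f(z)-f(x)-\langle u,z-x\rangle}{\|z-x\|}\ge0\}$. The proximity operator is $\operatorname{Prox}_{\gamma f}(x):=\operatorname{argmin}_{z\in X}\big(f(z)+\frac1{2\gamma}\|z-x\|^2\big)$. $\operatorname{zer}A:=\{x:0\in Ax\}$, $\operatorname{Fix}T=\{x:Tx=x\}$. $T$ is conically $\theta$-averaged ($\theta>0$) if $T=(1-\theta)\mathrm{Id}+\theta N$ for some nonexpansive $N$. *)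

theory Defs
  imports "HOL-Analysis.Analysis" "HOL-Library.Landau_Symbols"
begin

text \<open>Extended-real valued functions f : X \<Rightarrow> ]-\<infinity>,+\<infinity>] are modelled as
  functions into ereal that never take the value -\<infinity>.\<close>

definition edom :: "('a \<Rightarrow> ereal) \<Rightarrow> 'a set" where
  "edom f = {x. f x < \<infinity>}"

definition proper_fun :: "('a \<Rightarrow> ereal) \<Rightarrow> bool" where
  "proper_fun f \<longleftrightarrow> (\<forall>x. f x \<noteq> -\<infinity>) \<and> edom f \<noteq> {}"

definition lsc_fun :: "('a::topological_space \<Rightarrow> ereal) \<Rightarrow> bool" where
  "lsc_fun f \<longleftrightarrow> (\<forall>x. f x \<le> Liminf (at x) f)"

definition alpha_convex :: "real \<Rightarrow> ('a::real_normed_vector \<Rightarrow> ereal) \<Rightarrow> bool" where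
  "alpha_convex \<alpha> f \<longleftrightarrow>
     (\<forall>x\<in>edom f. \<forall>y\<in>edom f. \<forall>\<kappa>::real. 0 < \<kappa> \<and> \<kappa> < 1 \<longrightarrow>
        f ((1 - \<kappa>) *\<^sub>R x + \<kappa> *\<^sub>R y) + ereal (\<alpha> / 2 * \<kappa> * (1 - \<kappa>) * (norm (x - y))\<^sup>2)
          \<le> ereal (1 - \<kappa>) * f x + ereal \<kappa> * f y)"

definition frechet_subdiff :: "('a::real_inner \<Rightarrow> ereal) \<Rightarrow> 'a \<Rightarrow> 'a set" where
  "frechet_subdiff f x = {u. x \<in> edom f \<and>
     Liminf (at x) (\<lambda>z. (f z - f x - ereal (inner u (z - x))) / ereal (norm (z - x))) \<ge> 0}"

definition prox_set :: "real \<Rightarrow> ('a::real_normed_vector \<Rightarrow> ereal) \<Rightarrow> 'a \<Rightarrow> 'a set" where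
  "prox_set \<gamma> f x = {z. \<forall>w. f z + ereal (1 / (2 * \<gamma>) * (norm (z - x))\<^sup>2)
                              \<le> f w + ereal (1 / (2 * \<gamma>) * (norm (w - x))\<^sup>2)}"

definition Prox :: "real \<Rightarrow> ('a::real_normed_vector \<Rightarrow> ereal) \<Rightarrow> 'a \<Rightarrow> 'a" where
  "Prox \<gamma> f x = (THE z. z \<in> prox_set \<gamma> f x)"

definition S_set :: "real \<Rightarrow> real \<Rightarrow> ('a::real_normed_vector \<Rightarrow> ereal) \<Rightarrow> ('a \<Rightarrow> 'a) \<Rightarrow> 'a \<Rightarrow> 'a set" where
  "S_set \<gamma> \<delta> f gh x = (\<lambda>p. (1 - (1 + \<delta> / \<gamma>)) *\<^sub>R x + (1 + \<delta> / \<gamma>) *\<^sub>R p - \<delta> *\<^sub>R gh p) ` prox_set \<gamma> f x"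

definition S_op :: "real \<Rightarrow> real \<Rightarrow> ('a::real_normed_vector \<Rightarrow> ereal) \<Rightarrow> ('a \<Rightarrow> 'a) \<Rightarrow> 'a \<Rightarrow> 'a" where
  "S_op \<gamma> \<delta> f gh x = (let p = Prox \<gamma> f x in
      (1 - (1 + \<delta> / \<gamma>)) *\<^sub>R x + (1 + \<delta> / \<gamma>) *\<^sub>R p - \<delta> *\<^sub>R gh p)"

definition T_set :: "real \<Rightarrow> real \<Rightarrow> real \<Rightarrow> ('a::real_normed_vector \<Rightarrow> ereal) \<Rightarrow> ('a \<Rightarrow> ereal)
                      \<Rightarrow> ('a \<Rightarrow> 'a) \<Rightarrow> 'a \<Rightarrow> 'a set" where
  "T_set \<gamma> \<delta> \<eta> f g gh x =
     {x - \<eta> *\<^sub>R p + \<eta> *\<^sub>R q | p q. p \<in> prox_set \<gamma> f x \<and>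
        q \<in> prox_set \<delta> g ((1 - (1 + \<delta> / \<gamma>)) *\<^sub>R x + (1 + \<delta> / \<gamma>) *\<^sub>R p - \<delta> *\<^sub>R gh p)}"

definition T_op :: "real \<Rightarrow> real \<Rightarrow> real \<Rightarrow> ('a::real_normed_vector \<Rightarrow> ereal) \<Rightarrow> ('a \<Rightarrow> ereal)
                      \<Rightarrow> ('a \<Rightarrow> 'a) \<Rightarrow> 'a \<Rightarrow> 'a" where
  "T_op \<gamma> \<delta> \<eta> f g gh x = x - \<eta> *\<^sub>R Prox \<gamma> f x + \<eta> *\<^sub>R Prox \<delta> g (S_op \<gamma> \<delta> f gh x)"

definition nonexpansive :: "('a::real_normed_vector \<Rightarrow> 'a) \<Rightarrow> bool" where
  "nonexpansive N \<longleftrightarrow> (\<forall>x y. norm (N x - N y) \<le> norm (x - y))"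

definition conically_averaged :: "real \<Rightarrow> ('a::real_normed_vector \<Rightarrow> 'a set) \<Rightarrow> bool" where
  "conically_averaged \<theta> T \<longleftrightarrow> \<theta> > 0 \<and>
     (\<exists>N. nonexpansive N \<and> (\<forall>x. T x = {(1 - \<theta>) *\<^sub>R x + \<theta> *\<^sub>R N x}))"

definition zer_sum :: "('a::real_inner \<Rightarrow> ereal) \<Rightarrow> ('a \<Rightarrow> ereal) \<Rightarrow> ('a \<Rightarrow> 'a) \<Rightarrow> 'a set" where
  "zer_sum f g gh = {x. \<exists>u v. u \<in> frechet_subdiff f x \<and> v \<in> frechet_subdiff g x \<and> u + v + gh x = 0}"

definition argmin_fun :: "('a \<Rightarrow> ereal) \<Rightarrow> 'a set" where
  "argmin_fun F = {x. \<forall>y. F x \<le> F y}"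

definition weakly_converges :: "(nat \<Rightarrow> 'a::real_inner) \<Rightarrow> 'a \<Rightarrow> bool" where
  "weakly_converges xs l \<longleftrightarrow> (\<forall>y. (\<lambda>n. inner (xs n) y) \<longlonglongrightarrow> inner l y)"

end

theory Submission
  imports Defs
begin

text \<open>Write p and q for the two proximal points produced from x, so that T x = x - \<eta> (p - q).
  For two inputs, add the strong monotonicity inequalities of the subdifferentials of f and g
  (moduli \<alpha> and \<beta>, possibly negative) and the Baillon--Haddad inequality for the gradient of h,
  and complete squares: the map sending x to p - q is \<eta>*/2-cocoercive, where \<eta>* is the constant of the statement,
  which is conical averagedness.
  Along the iterates p - q tends to 0, and the terms discarded in completing the squares give strong
  convergence of the gradients of h and, if \<alpha> + \<beta> > 0, of the proximal points. If \<alpha> + \<beta> = 0,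
  the quadratic terms cancel in the limit and a first-order perturbation of the test point
  identifies the weak limit of p.\<close>

section \<open>Proximal points and subgradients\<close>

text \<open>The obstacle is that one of \<alpha>, \<beta> may be negative, so f or g may be
  nonconvex and its prox expansive. What survives is strong convexity of both prox objectives, from
  \<open>1 + \<gamma> * \<alpha> > 0\<close> and \<open>1 + \<delta> * \<beta> > 0\<close>, and the
  sign of \<alpha> + \<beta> once the two monotonicity inequalities are added. With \<open>P\<close>
  the change of p and \<open>D\<close> the change of p - q, that sum contains
  \<open>inner P D\<close> with coefficient
  \<open>1 - \<gamma> / \<delta> - 2 * \<beta> * \<gamma>\<close> and the square of \<open>P\<close>
  with coefficient \<open>\<gamma> * (\<alpha> + \<beta>)\<close>. If \<alpha> + \<beta> = 0, no
  square can absorb the mixed term, so it has to vanish: this fixes \<delta>. Otherwise it is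
  absorbed, and the coefficient of the square of \<open>D\<close> that is left yields the fraction
  in \<eta>s. The gradient of h costs \<open>\<gamma> / (2 * \<sigma>)\<close> in both cases. A prox
  is in general not weakly continuous, so weak convergence of the iterates alone does not locate the
  limit of p. One minimization lemma for midpoint-uniformly convex functions serves twice: for
  proximal points and for asymptotic centers.\<close>

lemma strongly_convex_minimizer:
  fixes F :: "'a::{real_inner, complete_space} \<Rightarrow> real"
  assumes "K \<noteq> {}" and "\<mu> > 0"
    and bdd: "\<And>z. z \<in> K \<Longrightarrow> m \<le> F z"
    and mid: "\<And>y z. y \<in> K \<Longrightarrow> z \<in> K \<Longrightarrow> (1/2) *\<^sub>R (y + z) \<in> K
        \<and> F ((1/2) *\<^sub>R (y + z)) + \<mu> * (norm (y - z))\<^sup>2 \<le> (F y + F z) / 2"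
    and lsc: "\<And>s z l. (\<And>n. s n \<in> K) \<Longrightarrow> s \<longlonglongrightarrow> z \<Longrightarrow> (\<lambda>n. F (s n)) \<longlonglongrightarrow> l \<Longrightarrow> z \<in> K \<and> F z \<le> l"
  shows "\<exists>z\<in>K. \<forall>w\<in>K. F z \<le> F w"
proof -
  define I where "I = Inf (F ` K)"
  have bb: "bdd_below (F ` K)" by (rule bdd_belowI2[OF bdd])
  have I_le: "I \<le> F z" if "z \<in> K" for z
    unfolding I_def using that bb by (simp add: cInf_lower)
  have "\<exists>z\<in>K. F z < I + 1 / real (Suc n)" for n
  proof -
    have "Inf (F ` K) < I + 1 / real (Suc n)" unfolding I_def by simp
    then show ?thesis using cInf_lessD[of "F ` K"] \<open>K \<noteq> {}\<close> by auto
  qed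
  then obtain s where sK: "\<And>n. s n \<in> K" and sI: "\<And>n. F (s n) < I + 1 / real (Suc n)"
    by metis
  have lim: "(\<lambda>n. F (s n)) \<longlonglongrightarrow> I"
  proof (rule tendsto_sandwich[of "\<lambda>_. I" _ _ "\<lambda>n. I + 1 / real (Suc n)"])
    show "(\<lambda>n. I + 1 / real (Suc n)) \<longlonglongrightarrow> I"
      using tendsto_add[OF tendsto_const[of I] LIMSEQ_inverse_real_of_nat]
      by (simp add: inverse_eq_divide)
  qed (use I_le sK sI in \<open>auto intro!: always_eventually less_imp_le\<close>)
  \<comment> \<open>The midpoint of two almost minimal points cannot fall below the infimum, so the
    convexity gain \<open>\<mu> * (norm (s i - s j))\<^sup>2\<close> is at most the mean excess of
    their values over \<open>I\<close>.\<close>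
  have "Cauchy s"
  proof (rule metric_CauchyI)
    fix e :: real assume "e > 0"
    then have "\<mu> * e\<^sup>2 > 0" using \<open>\<mu> > 0\<close> by simp
    then obtain M where M: "\<And>n. n \<ge> M \<Longrightarrow> F (s n) < I + \<mu> * e\<^sup>2"
      using order_tendstoD(2)[OF lim, of "I + \<mu> * e\<^sup>2"] by (auto simp: eventually_sequentially)
    have "dist (s i) (s j) < e" if "i \<ge> M" "j \<ge> M" for i j
    proof -
      have "I + \<mu> * (norm (s i - s j))\<^sup>2 \<le> (F (s i) + F (s j)) / 2"
        using mid[OF sK[of i] sK[of j]] I_le[of "(1/2) *\<^sub>R (s i + s j)"] by linarith
      then have "\<mu> * (norm (s i - s j))\<^sup>2 < \<mu> * e\<^sup>2" using M[of i] M[of j] that by simp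
      then have "(norm (s i - s j))\<^sup>2 < e\<^sup>2" using \<open>\<mu> > 0\<close> by simp
      then show ?thesis using \<open>e > 0\<close> by (simp add: dist_norm power2_less_imp_less)
    qed
    then show "\<exists>M. \<forall>m\<ge>M. \<forall>n\<ge>M. dist (s m) (s n) < e" by blast
  qed
  then obtain z where "s \<longlonglongrightarrow> z" using Cauchy_convergent_iff convergent_def by blast
  then have "z \<in> K \<and> F z \<le> I" using lsc sK lim by blast
  then show ?thesis using I_le order_trans by blast
qed

section \<open>From extended-real to real inequalities on the domain\<close>

lemma proper_fun_eq_real:
  "proper_fun f \<Longrightarrow> x \<in> edom f \<Longrightarrow> f x = ereal (real_of_ereal (f x))"
  unfolding proper_fun_def edom_def by (cases "f x") auto

lemma alpha_convexD:
  assumes "proper_fun f" "alpha_convex \<alpha> f" "x \<in> edom f" "y \<in> edom f" "0 < \<kappa>" "\<kappa> < 1"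
  shows "(1 - \<kappa>) *\<^sub>R x + \<kappa> *\<^sub>R y \<in> edom f"
    and "real_of_ereal (f ((1 - \<kappa>) *\<^sub>R x + \<kappa> *\<^sub>R y)) + \<alpha> / 2 * \<kappa> * (1 - \<kappa>) * (norm (x - y))\<^sup>2
      \<le> (1 - \<kappa>) * real_of_ereal (f x) + \<kappa> * real_of_ereal (f y)"
proof -
  let ?w = "(1 - \<kappa>) *\<^sub>R x + \<kappa> *\<^sub>R y"
  have *: "f ?w + ereal (\<alpha> / 2 * \<kappa> * (1 - \<kappa>) * (norm (x - y))\<^sup>2)
      \<le> ereal (1 - \<kappa>) * f x + ereal \<kappa> * f y"
    using assms unfolding alpha_convex_def by blast
  obtain a b where ab: "f x = ereal a" "f y = ereal b"
    using proper_fun_eq_real[OF assms(1,3)] proper_fun_eq_real[OF assms(1,4)] by blast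
  have nm: "f ?w \<noteq> -\<infinity>" using assms(1) by (auto simp: proper_fun_def)
  have "f ?w \<noteq> \<infinity>" using * ab by auto
  then show "?w \<in> edom f" by (simp add: edom_def less_top[symmetric] top_ereal_def)
  show "real_of_ereal (f ?w) + \<alpha> / 2 * \<kappa> * (1 - \<kappa>) * (norm (x - y))\<^sup>2
      \<le> (1 - \<kappa>) * real_of_ereal (f x) + \<kappa> * real_of_ereal (f y)"
    using * ab nm \<open>f ?w \<noteq> \<infinity>\<close> by (cases "f ?w") auto
qed

text \<open>\<open>lsc_fun\<close> compares with the Liminf over punctured neighbourhoods; the bound
  at the point itself comes from the second hypothesis.\<close>

lemma lsc_fun_nhds:
  assumes "lsc_fun f" "C < f z"
  shows "eventually (\<lambda>w. C < f w) (nhds z)"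
proof -
  have "C < Liminf (at z) f" using assms unfolding lsc_fun_def by (meson less_le_trans)
  then have "eventually (\<lambda>w. C < f w) (at z)" by (rule less_LiminfD)
  then show ?thesis using assms(2) by (auto simp: eventually_at_filter elim!: eventually_mono)
qed

lemma lsc_fun_sequentially:
  assumes "proper_fun f" "lsc_fun f" "\<And>n. s n \<in> edom f" "s \<longlonglongrightarrow> z"
    "(\<lambda>n. real_of_ereal (f (s n))) \<longlonglongrightarrow> l"
  shows "z \<in> edom f \<and> real_of_ereal (f z) \<le> l"
proof -
  have "f z \<le> ereal l"
  proof (rule ccontr)
    assume "\<not> f z \<le> ereal l"
    then obtain C where C: "ereal l < ereal C" "ereal C < f z"
      using ereal_dense2[of "ereal l" "f z"] by (metis not_le)
    have "eventually (\<lambda>n. ereal C < f (s n)) sequentially"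
      using lsc_fun_nhds[OF assms(2) C(2)] assms(4) by (rule eventually_compose_filterlim)
    then have "eventually (\<lambda>n. C \<le> real_of_ereal (f (s n))) sequentially"
    proof eventually_elim
      case (elim n)
      then have "ereal C < ereal (real_of_ereal (f (s n)))"
        using proper_fun_eq_real[OF assms(1) assms(3)[of n]] by metis
      then show ?case by simp
    qed
    then have "C \<le> l" using assms(5) by (intro tendsto_lowerbound) auto
    with C show False by simp
  qed
  moreover from this have "z \<in> edom f" by (auto simp: edom_def order_le_less_trans)
  moreover have "f z \<noteq> -\<infinity>" using assms(1) by (auto simp: proper_fun_def)
  ultimately show ?thesis by (cases "f z") auto
qed

text \<open>Equivalently, \<open>u - \<alpha> *\<^sub>R p\<close> is a convex subgradient at p of f
  minus \<alpha>/2 times the squared norm. This global form stands in for both the Frechet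
  subdifferential and the optimality condition of the prox.\<close>

definition alpha_subgradient :: "real \<Rightarrow> ('a::real_inner \<Rightarrow> ereal) \<Rightarrow> 'a \<Rightarrow> 'a \<Rightarrow> bool" where
  "alpha_subgradient \<alpha> f p u \<longleftrightarrow> p \<in> edom f \<and>
     (\<forall>z\<in>edom f. real_of_ereal (f p) + inner u (z - p) + \<alpha> / 2 * (norm (z - p))\<^sup>2 \<le> real_of_ereal (f z))"

text \<open>Convexity transports a first-order bound near p to every z: apply it at the point
  \<open>(1 - \<kappa>) *\<^sub>R p + \<kappa> *\<^sub>R z\<close>, divide by \<kappa> and let
  \<kappa> tend to 0. The factor 1 - \<kappa> in the convexity gain then becomes 1, which produces
  the full modulus \<alpha>.\<close>

lemma alpha_subgradient_local:
  assumes pf: "proper_fun f" "alpha_convex \<alpha> f" and p: "p \<in> edom f"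
    and loc: "\<And>\<epsilon>. \<epsilon> > 0 \<Longrightarrow> \<exists>r>0. \<forall>w\<in>edom f. norm (w - p) < r \<longrightarrow>
        real_of_ereal (f p) + inner u (w - p) - \<epsilon> * norm (w - p) \<le> real_of_ereal (f w)"
  shows "alpha_subgradient \<alpha> f p u"
  unfolding alpha_subgradient_def
proof (intro conjI ballI p)
  fix z assume z: "z \<in> edom f"
  let ?F = "\<lambda>x. real_of_ereal (f x)"
  define d where "d = norm (z - p)"
  have d0: "d \<ge> 0" by (simp add: d_def)
  have step: "?F p + inner u (z - p) - \<epsilon> * d \<le> ?F z - \<alpha> / 2 * d\<^sup>2" if "\<epsilon> > 0" for \<epsilon>
  proof -
    obtain r where r: "r > 0" and w: "\<And>w. w \<in> edom f \<Longrightarrow> norm (w - p) < r \<Longrightarrow>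
        ?F p + inner u (w - p) - \<epsilon> * norm (w - p) \<le> ?F w" using loc[OF \<open>\<epsilon> > 0\<close>] by blast
    \<comment> \<open>Such \<kappa> keep the intermediate point within distance r of p;
      \<open>d + 1\<close> in place of \<open>d\<close> covers z = p.\<close>
    have "eventually (\<lambda>\<kappa>. \<kappa> < min 1 (r / (d + 1))) (at_right (0::real))"
      using r d0 by (intro order_tendstoD(2)[OF tendsto_ident_at]) (simp add: add_nonneg_pos)
    moreover have "eventually (\<lambda>\<kappa>. \<kappa> > 0) (at_right (0::real))" by (simp add: eventually_at_filter)
    ultimately have ev: "eventually (\<lambda>\<kappa>. ?F p + inner u (z - p) - \<epsilon> * d \<le> ?F z - \<alpha> / 2 * (1 - \<kappa>) * d\<^sup>2) (at_right 0)"
    proof eventually_elim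
      case (elim \<kappa>)
      let ?w = "(1 - \<kappa>) *\<^sub>R p + \<kappa> *\<^sub>R z"
      have wp: "?w - p = \<kappa> *\<^sub>R (z - p)" by (simp add: algebra_simps)
      have nw: "norm (?w - p) = \<kappa> * d" unfolding wp d_def using elim by simp
      have "\<kappa> * (d + 1) < r" using elim d0 by (simp add: pos_less_divide_eq)
      then have "\<kappa> * d < r" using elim by (simp add: algebra_simps)
      moreover have we: "?w \<in> edom f" using alpha_convexD(1)[OF pf p z] elim by simp
      ultimately have "?F p + \<kappa> * inner u (z - p) - \<epsilon> * (\<kappa> * d) \<le> ?F ?w"
        using w[OF we] nw wp by simp
      moreover have "?F ?w + \<alpha> / 2 * \<kappa> * (1 - \<kappa>) * d\<^sup>2 \<le> (1 - \<kappa>) * ?F p + \<kappa> * ?F z"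
        using alpha_convexD(2)[OF pf p z] elim by (simp add: d_def norm_minus_commute)
      ultimately have "\<kappa> * (?F p + inner u (z - p) - \<epsilon> * d) \<le> \<kappa> * (?F z - \<alpha> / 2 * (1 - \<kappa>) * d\<^sup>2)"
        by (simp add: algebra_simps)
      then show ?case using elim by simp
    qed
    have "((\<lambda>\<kappa>. ?F z - \<alpha> / 2 * (1 - \<kappa>) * d\<^sup>2) \<longlongrightarrow> ?F z - \<alpha> / 2 * (1 - 0) * d\<^sup>2) (at_right 0)"
      by (intro tendsto_intros)
    from tendsto_lowerbound[OF this ev] show ?thesis by simp
  qed
  have "?F p + inner u (z - p) + \<alpha> / 2 * d\<^sup>2 \<le> ?F z + e" if "e > 0" for e
  proof -
    have "e / (d + 1) * d \<le> e" using that d0 by (simp add: field_simps)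
    then show ?thesis using step[of "e / (d + 1)"] that d0 by simp
  qed
  then show "?F p + inner u (z - p) + \<alpha> / 2 * (norm (z - p))\<^sup>2 \<le> ?F z"
    unfolding d_def by (rule field_le_epsilon)
qed

text \<open>One direction is the passage from local to global bounds. In the other, the quadratic
  term divided by \<open>norm (z - p)\<close> tends to 0 whatever the sign of \<alpha>.\<close>

lemma frechet_subdiff_iff:
  assumes pf: "proper_fun f" "alpha_convex \<alpha> f"
  shows "u \<in> frechet_subdiff f p \<longleftrightarrow> alpha_subgradient \<alpha> f p u"
proof
  let ?F = "\<lambda>x. real_of_ereal (f x)"
  let ?Q = "\<lambda>z. (f z - f p - ereal (inner u (z - p))) / ereal (norm (z - p))"
  note real = proper_fun_eq_real[OF pf(1)]
  assume u: "u \<in> frechet_subdiff f p"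
  then have p: "p \<in> edom f" and L: "Liminf (at p) ?Q \<ge> 0" by (auto simp: frechet_subdiff_def)
  show "alpha_subgradient \<alpha> f p u"
  proof (rule alpha_subgradient_local[OF pf p])
    fix \<epsilon> :: real assume "\<epsilon> > 0"
    then have "ereal (- \<epsilon>) < Liminf (at p) ?Q" using L by (intro less_le_trans[OF _ L]) simp
    then have "eventually (\<lambda>z. ereal (- \<epsilon>) < ?Q z) (at p)" by (rule less_LiminfD)
    then obtain r where r: "r > 0" "\<And>z. z \<noteq> p \<Longrightarrow> dist z p < r \<Longrightarrow> ereal (- \<epsilon>) < ?Q z"
      unfolding eventually_at by blast
    have "?F p + inner u (w - p) - \<epsilon> * norm (w - p) \<le> ?F w" if w: "w \<in> edom f" "norm (w - p) < r" for w
    proof (cases "w = p")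
      case False
      have "ereal (- \<epsilon>) < ?Q w" using r(2) False w(2) by (simp add: dist_norm)
      also have "?Q w = ereal ((?F w - ?F p - inner u (w - p)) / norm (w - p))"
        using False by (subst real[OF w(1)], subst real[OF p]) simp
      finally have "- \<epsilon> < (?F w - ?F p - inner u (w - p)) / norm (w - p)" by simp
      then show ?thesis using False by (simp add: pos_less_divide_eq)
    qed simp
    then show "\<exists>r>0. \<forall>w\<in>edom f. norm (w - p) < r \<longrightarrow>
        ?F p + inner u (w - p) - \<epsilon> * norm (w - p) \<le> ?F w" using r(1) by blast
  qed
next
  let ?F = "\<lambda>x. real_of_ereal (f x)"
  let ?Q = "\<lambda>z. (f z - f p - ereal (inner u (z - p))) / ereal (norm (z - p))"
  note real = proper_fun_eq_real[OF pf(1)]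
  assume "alpha_subgradient \<alpha> f p u"
  then have p: "p \<in> edom f" and ineq: "\<And>z. z \<in> edom f \<Longrightarrow>
      ?F p + inner u (z - p) + \<alpha> / 2 * (norm (z - p))\<^sup>2 \<le> ?F z"
    by (auto simp: alpha_subgradient_def)
  have low: "ereal (\<alpha> / 2 * norm (z - p)) \<le> ?Q z" if "z \<noteq> p" for z
  proof (cases "z \<in> edom f")
    case True
    have "\<alpha> / 2 * norm (z - p) \<le> (?F z - ?F p - inner u (z - p)) / norm (z - p)"
      using ineq[OF True] that by (simp add: pos_le_divide_eq power2_eq_square)
    moreover have "?Q z = ereal ((?F z - ?F p - inner u (z - p)) / norm (z - p))"
      using that by (subst real[OF True], subst real[OF p]) simp
    ultimately show ?thesis by simp
  next
    case False
    then have "f z = \<infinity>" by (auto simp: edom_def)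
    then have "?Q z = \<infinity>" using that by (subst real[OF p]) simp
    then show ?thesis by simp
  qed
  have "0 \<le> Liminf (at p) ?Q"
  \<comment> \<open>In the zero space the punctured filter is trivial and its Liminf is \<infinity>;
    the limit argument requires a nontrivial filter.\<close>
  proof (cases "at p = bot")
    case False
    have "((\<lambda>z. ereal (\<alpha> / 2 * norm (z - p))) \<longlongrightarrow> ereal (\<alpha> / 2 * norm (p - p))) (at p)"
      by (intro tendsto_intros)
    from lim_imp_Liminf[OF False this]
    have "Liminf (at p) (\<lambda>z. ereal (\<alpha> / 2 * norm (z - p))) = 0" by (simp add: zero_ereal_def)
    moreover have "Liminf (at p) (\<lambda>z. ereal (\<alpha> / 2 * norm (z - p))) \<le> Liminf (at p) ?Q"
      by (rule Liminf_mono) (use low in \<open>auto simp: eventually_at_filter\<close>)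
    ultimately show ?thesis by simp
  qed simp
  then show "u \<in> frechet_subdiff f p" using p by (simp add: frechet_subdiff_def)
qed

lemma alpha_subgradient_monotone:
  assumes "alpha_subgradient \<alpha> f p u" "alpha_subgradient \<alpha> f q v"
  shows "\<alpha> * (norm (p - q))\<^sup>2 \<le> inner (u - v) (p - q)"
proof -
  have "real_of_ereal (f p) + inner u (q - p) + \<alpha> / 2 * (norm (q - p))\<^sup>2 \<le> real_of_ereal (f q)"
    and "real_of_ereal (f q) + inner v (p - q) + \<alpha> / 2 * (norm (p - q))\<^sup>2 \<le> real_of_ereal (f p)"
    using assms by (auto simp: alpha_subgradient_def)
  moreover have "inner u (q - p) = - inner u (p - q)" by (simp add: inner_diff_right)
  ultimately show ?thesis by (simp add: inner_diff_left norm_minus_commute)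
qed

text \<open>Expanding the squared distance to x around p gives the linear term with slope (x -
  p)/\<gamma> and the error \<open>1 / (2 * \<gamma>) * (norm (w - p))\<^sup>2\<close>. For a
  minimizer this error is of second order, so the local lemma replaces it by the modulus \<alpha>,
  without a subdifferential sum rule. Conversely, \<alpha>/2 + 1/(2\<gamma>) is nonnegative.\<close>

lemma prox_set_iff:
  assumes pf: "proper_fun f" "alpha_convex \<alpha> f" and \<gamma>: "\<gamma> > 0" "1 + \<gamma> * \<alpha> > 0"
  shows "p \<in> prox_set \<gamma> f x \<longleftrightarrow> alpha_subgradient \<alpha> f p ((1 / \<gamma>) *\<^sub>R (x - p))"
proof -
  let ?F = "\<lambda>x. real_of_ereal (f x)"
  note real = proper_fun_eq_real[OF pf(1)]
  have id: "1 / (2 * \<gamma>) * (norm (p - x))\<^sup>2 - 1 / (2 * \<gamma>) * (norm (w - x))\<^sup>2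
      = inner ((1 / \<gamma>) *\<^sub>R (x - p)) (w - p) - 1 / (2 * \<gamma>) * (norm (w - p))\<^sup>2" for w
    using \<gamma>(1) unfolding power2_norm_eq_inner
    by (simp add: inner_diff_left inner_diff_right inner_commute field_simps)
  show ?thesis
  proof
    assume P: "p \<in> prox_set \<gamma> f x"
    obtain y where y: "y \<in> edom f" using pf(1) by (auto simp: proper_fun_def)
    have P': "f p + ereal (1 / (2 * \<gamma>) * (norm (p - x))\<^sup>2) \<le> f w + ereal (1 / (2 * \<gamma>) * (norm (w - x))\<^sup>2)" for w
      using P by (simp add: prox_set_def)
    have "f p \<noteq> \<infinity>" using P'[of y] y by (cases "f y") (auto simp: edom_def)
    then have p: "p \<in> edom f" by (auto simp: edom_def)
    have ineq: "?F p + inner ((1 / \<gamma>) *\<^sub>R (x - p)) (w - p) - 1 / (2 * \<gamma>) * (norm (w - p))\<^sup>2 \<le> ?F w"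
      if "w \<in> edom f" for w
    proof -
      have "?F p + 1 / (2 * \<gamma>) * (norm (p - x))\<^sup>2 \<le> ?F w + 1 / (2 * \<gamma>) * (norm (w - x))\<^sup>2"
        using P'[of w] real[OF p] real[OF that] by (cases "f p"; cases "f w") auto
      then show ?thesis using id[of w] by linarith
    qed
    show "alpha_subgradient \<alpha> f p ((1 / \<gamma>) *\<^sub>R (x - p))"
    proof (rule alpha_subgradient_local[OF pf p])
      fix \<epsilon> :: real assume e: "\<epsilon> > 0"
      have "?F p + inner ((1 / \<gamma>) *\<^sub>R (x - p)) (w - p) - \<epsilon> * norm (w - p) \<le> ?F w"
        \<comment> \<open>Within this radius the quadratic error is at most
          \<open>\<epsilon> * norm (w - p)\<close>.\<close>
        if "w \<in> edom f" "norm (w - p) < 2 * \<gamma> * \<epsilon>" for w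
      proof -
        have "1 / (2 * \<gamma>) * norm (w - p) \<le> \<epsilon>" using that(2) \<gamma> by (simp add: field_simps)
        then have "1 / (2 * \<gamma>) * norm (w - p) * norm (w - p) \<le> \<epsilon> * norm (w - p)"
          by (rule mult_right_mono) simp
        then show ?thesis using ineq[OF that(1)] by (simp add: power2_eq_square)
      qed
      then show "\<exists>r>0. \<forall>w\<in>edom f. norm (w - p) < r \<longrightarrow>
          ?F p + inner ((1 / \<gamma>) *\<^sub>R (x - p)) (w - p) - \<epsilon> * norm (w - p) \<le> ?F w"
        using e \<gamma>(1) by (intro exI[of _ "2 * \<gamma> * \<epsilon>"]) auto
    qed
  next
    assume "alpha_subgradient \<alpha> f p ((1 / \<gamma>) *\<^sub>R (x - p))"
    then have p: "p \<in> edom f" and ineq: "\<And>w. w \<in> edom f \<Longrightarrow>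
        ?F p + inner ((1 / \<gamma>) *\<^sub>R (x - p)) (w - p) + \<alpha> / 2 * (norm (w - p))\<^sup>2 \<le> ?F w"
      by (auto simp: alpha_subgradient_def)
    have "f p + ereal (1 / (2 * \<gamma>) * (norm (p - x))\<^sup>2) \<le> f w + ereal (1 / (2 * \<gamma>) * (norm (w - x))\<^sup>2)" for w
    proof (cases "w \<in> edom f")
      case True
      have "0 \<le> (1 + \<gamma> * \<alpha>) / (2 * \<gamma>) * (norm (w - p))\<^sup>2" using \<gamma> by simp
      also have "\<dots> = 1 / (2 * \<gamma>) * (norm (w - p))\<^sup>2 + \<alpha> / 2 * (norm (w - p))\<^sup>2"
        using \<gamma> by (simp add: field_simps)
      finally have "?F p + 1 / (2 * \<gamma>) * (norm (p - x))\<^sup>2 \<le> ?F w + 1 / (2 * \<gamma>) * (norm (w - x))\<^sup>2"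
        using id[of w] ineq[OF True] by linarith
      then show ?thesis using real[OF p] real[OF True] by (cases "f p"; cases "f w") auto
    next
      case False
      then have "f w = \<infinity>" by (auto simp: edom_def)
      then show ?thesis by simp
    qed
    then show "p \<in> prox_set \<gamma> f x" by (simp add: prox_set_def)
  qed
qed

text \<open>Lower semicontinuity bounds f near one point of its domain; convexity along the segments
  from that point turns this into a global linear-plus-quadratic lower bound, which replaces
  the usual affine minorant.\<close>
lemma alpha_convex_lower_bound:
  assumes pf: "proper_fun f" "lsc_fun f" "alpha_convex \<alpha> f"
  shows "\<exists>a\<in>edom f. \<exists>A B. \<forall>z\<in>edom f. A - B * norm (z - a) + \<alpha> / 2 * (norm (z - a))\<^sup>2 \<le> real_of_ereal (f z)"
proof -
  let ?F = "\<lambda>x. real_of_ereal (f x)"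
  note real = proper_fun_eq_real[OF pf(1)]
  obtain a where a: "a \<in> edom f" using pf(1) by (auto simp: proper_fun_def)
  have "ereal (?F a - 1) < f a" by (subst (2) real[OF a]) simp
  then have "eventually (\<lambda>w. ereal (?F a - 1) < f w) (nhds a)" by (rule lsc_fun_nhds[OF pf(2)])
  then obtain r0 where r0: "r0 > 0" "\<And>w. dist w a < r0 \<Longrightarrow> ereal (?F a - 1) < f w"
    unfolding eventually_nhds_metric by blast
  define r where "r = r0 / 2"
  have r: "r > 0" "r < r0" using r0(1) by (auto simp: r_def)
  have near: "?F a - 1 \<le> ?F w" if "w \<in> edom f" "norm (w - a) \<le> r" for w
  proof -
    have "ereal (?F a - 1) < f w" using r0(2)[of w] that r by (simp add: dist_norm)
    then show ?thesis by (subst (asm) real[OF that(1)]) simp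
  qed
  have "?F a - 1 - \<bar>\<alpha>\<bar> / 2 * r\<^sup>2 - (1 / r + \<bar>\<alpha>\<bar> / 2 * r) * norm (z - a) + \<alpha> / 2 * (norm (z - a))\<^sup>2 \<le> ?F z"
    if z: "z \<in> edom f" for z
  proof (cases "norm (z - a) \<le> r")
    case True
    have "\<alpha> / 2 * (norm (z - a))\<^sup>2 \<le> \<bar>\<alpha>\<bar> / 2 * r\<^sup>2"
      using True by (intro mult_mono power_mono) auto
    moreover have "0 \<le> (1 / r + \<bar>\<alpha>\<bar> / 2 * r) * norm (z - a)" using r by simp
    ultimately show ?thesis using near[OF z True] by linarith
  next
    case False
    define d where "d = norm (z - a)"
    define k where "k = r / d"
    have d: "d > r" using False d_def by simp
    have k: "0 < k" "k < 1" "k * d = r" using d r by (auto simp: k_def)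
    let ?w = "(1 - k) *\<^sub>R a + k *\<^sub>R z"
    have "?w - a = k *\<^sub>R (z - a)" by (simp add: algebra_simps)
    then have "norm (?w - a) = r" using k d_def by simp
    then have "?F a - 1 \<le> ?F ?w" using near[of ?w] alpha_convexD(1)[OF pf(1,3) a z k(1,2)] by simp
    moreover have "?F ?w + \<alpha> / 2 * k * (1 - k) * d\<^sup>2 \<le> (1 - k) * ?F a + k * ?F z"
      using alpha_convexD(2)[OF pf(1,3) a z k(1,2)] by (simp add: d_def norm_minus_commute)
    ultimately have "k * (?F a + \<alpha> / 2 * (1 - k) * d\<^sup>2) - 1 \<le> k * ?F z" by (simp add: algebra_simps)
    \<comment> \<open>The constant loss 1 is written as a multiple of \<open>k\<close>, so that
      dividing by \<open>k\<close> turns it into the linear term d/r; hence the summand 1/r in the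
      slope.\<close>
    moreover have "k * (d / r) = 1" using k(3) r by simp
    ultimately have "k * (?F a + \<alpha> / 2 * (1 - k) * d\<^sup>2 - d / r) \<le> k * ?F z"
      by (simp only: right_diff_distrib)
    then have "?F a + \<alpha> / 2 * (1 - k) * d\<^sup>2 - d / r \<le> ?F z" using k by simp
    moreover have "\<alpha> / 2 * (1 - k) * d\<^sup>2 = \<alpha> / 2 * d\<^sup>2 - \<alpha> / 2 * (k * d) * d"
      by (simp add: field_simps power2_eq_square)
    moreover have "\<alpha> / 2 * r * d \<le> \<bar>\<alpha>\<bar> / 2 * r * d"
      using r d by (intro mult_right_mono) auto
    moreover have "(1 / r + \<bar>\<alpha>\<bar> / 2 * r) * d = d / r + \<bar>\<alpha>\<bar> / 2 * r * d" by (simp add: distrib_right)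
    ultimately have "?F a - (1 / r + \<bar>\<alpha>\<bar> / 2 * r) * d + \<alpha> / 2 * d\<^sup>2 \<le> ?F z"
      unfolding k(3) by linarith
    moreover have "0 \<le> \<bar>\<alpha>\<bar> / 2 * r\<^sup>2" by simp
    ultimately show ?thesis unfolding d_def by linarith
  qed
  then show ?thesis using a by blast
qed

text \<open>The quadratic of the prox outweighs a negative \<alpha>, so the objective is strongly
  convex; the linear-plus-quadratic minorant of f then bounds it below.\<close>

lemma prox_set_nonempty:
  fixes f :: "'a::{real_inner, complete_space} \<Rightarrow> ereal"
  assumes pf: "proper_fun f" "lsc_fun f" "alpha_convex \<alpha> f" and \<gamma>: "\<gamma> > 0" "1 + \<gamma> * \<alpha> > 0"
  shows "prox_set \<gamma> f x \<noteq> {}"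
proof -
  let ?F = "\<lambda>x. real_of_ereal (f x)"
  let ?G = "\<lambda>z. ?F z + 1 / (2 * \<gamma>) * (norm (z - x))\<^sup>2"
  note real = proper_fun_eq_real[OF pf(1)]
  \<comment> \<open>Half the strong convexity modulus \<alpha> + 1/\<gamma> of the objective; a
    midpoint therefore gains \<mu>/4 times the squared distance.\<close>
  define \<mu> where "\<mu> = (1 + \<gamma> * \<alpha>) / (2 * \<gamma>)"
  have \<mu>: "\<mu> > 0" "\<mu> = \<alpha> / 2 + 1 / (2 * \<gamma>)" using \<gamma> by (auto simp: \<mu>_def field_simps)
  obtain a A B where a: "a \<in> edom f"
    and AB: "\<And>z. z \<in> edom f \<Longrightarrow> A - B * norm (z - a) + \<alpha> / 2 * (norm (z - a))\<^sup>2 \<le> ?F z"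
    using alpha_convex_lower_bound[OF pf] by blast
  \<comment> \<open>The extra slope pays for recentering the squared distance from x to a. The bound
    below is the minimum of \<open>A - B' * d + \<mu> * d\<^sup>2\<close> over d.\<close>
  define B' where "B' = B + 1 / \<gamma> * norm (a - x)"
  have low: "A - B'\<^sup>2 / (4 * \<mu>) \<le> ?G z" if "z \<in> edom f" for z
  proof -
    define d where "d = norm (z - a)"
    have "(norm (z - x))\<^sup>2 = d\<^sup>2 + 2 * inner (z - a) (a - x) + (norm (a - x))\<^sup>2"
      unfolding d_def power2_norm_eq_inner by (simp add: inner_diff_left inner_diff_right inner_commute)
    moreover have "\<bar>inner (z - a) (a - x)\<bar> \<le> d * norm (a - x)"
      unfolding d_def by (rule Cauchy_Schwarz_ineq2)
    moreover have "0 \<le> (norm (a - x))\<^sup>2" by simp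
    ultimately have "d\<^sup>2 - 2 * d * norm (a - x) \<le> (norm (z - x))\<^sup>2" by linarith
    then have "1 / (2 * \<gamma>) * (d\<^sup>2 - 2 * d * norm (a - x)) \<le> 1 / (2 * \<gamma>) * (norm (z - x))\<^sup>2"
      using \<gamma> by (intro mult_left_mono) auto
    moreover have "1 / (2 * \<gamma>) * (d\<^sup>2 - 2 * d * norm (a - x)) = 1 / (2 * \<gamma>) * d\<^sup>2 - 1 / \<gamma> * norm (a - x) * d"
      by (simp add: algebra_simps)
    ultimately have "A - B' * d + \<mu> * d\<^sup>2 \<le> ?G z"
      using AB[OF that] unfolding \<mu>(2) B'_def d_def[symmetric] by (simp add: distrib_right)
    moreover have "0 \<le> (2 * \<mu> * d - B')\<^sup>2 / (4 * \<mu>)" using \<mu> by simp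
    moreover have "(2 * \<mu> * d - B')\<^sup>2 = 4 * \<mu> * (\<mu> * d\<^sup>2 - B' * d) + B'\<^sup>2"
      by (simp add: power2_eq_square algebra_simps)
    then have "(2 * \<mu> * d - B')\<^sup>2 / (4 * \<mu>) = \<mu> * d\<^sup>2 - B' * d + B'\<^sup>2 / (4 * \<mu>)"
      using \<mu>(1) by (simp add: add_divide_distrib)
    ultimately show ?thesis by linarith
  qed
  have "\<exists>z\<in>edom f. \<forall>w\<in>edom f. ?G z \<le> ?G w"
  proof (rule strongly_convex_minimizer[where \<mu> = "\<mu> / 4" and m = "A - B'\<^sup>2 / (4 * \<mu>)"])
    show "edom f \<noteq> {}" using a by blast
    show "\<mu> / 4 > 0" using \<mu> by simp
    show "A - B'\<^sup>2 / (4 * \<mu>) \<le> ?G z" if "z \<in> edom f" for z using low[OF that] .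
  next
    fix y z assume yz: "y \<in> edom f" "z \<in> edom f"
    have eq: "(1 - 1/2) *\<^sub>R y + (1/2) *\<^sub>R z = (1/2::real) *\<^sub>R (y + z)" by (simp add: scaleR_right_distrib)
    note c = alpha_convexD[OF pf(1,3) yz, of "1/2", unfolded eq]
    have "(norm ((1/2) *\<^sub>R (y + z) - x))\<^sup>2 = ((norm (y - x))\<^sup>2 + (norm (z - x))\<^sup>2) / 2 - (norm (y - z))\<^sup>2 / 4"
      unfolding power2_norm_eq_inner
      by (simp add: inner_diff_left inner_diff_right inner_add_left inner_add_right inner_commute field_simps)
    then have "1 / (2 * \<gamma>) * (norm ((1/2) *\<^sub>R (y + z) - x))\<^sup>2
      = 1 / (2 * \<gamma>) * (((norm (y - x))\<^sup>2 + (norm (z - x))\<^sup>2) / 2 - (norm (y - z))\<^sup>2 / 4)" by simp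
    also have "\<dots> = (1 / (2 * \<gamma>) * (norm (y - x))\<^sup>2 + 1 / (2 * \<gamma>) * (norm (z - x))\<^sup>2) / 2
        - 1 / (2 * \<gamma>) * (norm (y - z))\<^sup>2 / 4" by (simp add: algebra_simps add_divide_distrib)
    finally show "(1/2) *\<^sub>R (y + z) \<in> edom f \<and>
        ?G ((1/2) *\<^sub>R (y + z)) + \<mu> / 4 * (norm (y - z))\<^sup>2 \<le> (?G y + ?G z) / 2"
      using c unfolding \<mu>(2) by (simp add: distrib_right add_divide_distrib)
  next
    fix s z l assume s: "\<And>n. s n \<in> edom f" "s \<longlonglongrightarrow> z" "(\<lambda>n. ?G (s n)) \<longlonglongrightarrow> l"
    have "(\<lambda>n. ?G (s n) - 1 / (2 * \<gamma>) * (norm (s n - x))\<^sup>2) \<longlonglongrightarrow> l - 1 / (2 * \<gamma>) * (norm (z - x))\<^sup>2"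
      by (intro tendsto_intros s)
    then have "(\<lambda>n. ?F (s n)) \<longlonglongrightarrow> l - 1 / (2 * \<gamma>) * (norm (z - x))\<^sup>2" by simp
    from lsc_fun_sequentially[OF pf(1,2) s(1,2) this]
    show "z \<in> edom f \<and> ?G z \<le> l" by simp
  qed
  then obtain z where z: "z \<in> edom f" "\<And>w. w \<in> edom f \<Longrightarrow> ?G z \<le> ?G w" by blast
  have "f z + ereal (1 / (2 * \<gamma>) * (norm (z - x))\<^sup>2) \<le> f w + ereal (1 / (2 * \<gamma>) * (norm (w - x))\<^sup>2)" for w
  proof (cases "w \<in> edom f")
    case True
    then show ?thesis using z(2)[OF True] real[OF z(1)] real[OF True]
      by (cases "f z"; cases "f w") auto
  next
    case False
    then have "f w = \<infinity>" by (auto simp: edom_def)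
    then show ?thesis by simp
  qed
  then show ?thesis by (auto simp: prox_set_def)
qed

text \<open>Stated for pairs satisfying the optimality condition, so that x = y gives uniqueness
  before \<open>Prox\<close> is known to be well defined. For negative \<alpha> the constant exceeds
  1.\<close>

lemma prox_lipschitz:
  assumes "alpha_subgradient \<alpha> f p ((1 / \<gamma>) *\<^sub>R (x - p))"
    and "alpha_subgradient \<alpha> f q ((1 / \<gamma>) *\<^sub>R (y - q))"
    and \<gamma>: "\<gamma> > 0" "1 + \<gamma> * \<alpha> > 0"
  shows "norm (p - q) \<le> norm (x - y) / (1 + \<gamma> * \<alpha>)"
proof -
  have "\<alpha> * (norm (p - q))\<^sup>2 \<le> inner ((1 / \<gamma>) *\<^sub>R (x - p) - (1 / \<gamma>) *\<^sub>R (y - q)) (p - q)"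
    using alpha_subgradient_monotone[OF assms(1,2)] .
  also have "\<dots> = (1 / \<gamma>) * (inner (x - y) (p - q) - (norm (p - q))\<^sup>2)"
    unfolding power2_norm_eq_inner by (simp add: inner_diff_left algebra_simps)
  finally have "(1 + \<gamma> * \<alpha>) * (norm (p - q))\<^sup>2 \<le> inner (x - y) (p - q)"
    using \<gamma>(1) by (simp add: field_simps)
  also have "\<dots> \<le> norm (x - y) * norm (p - q)" by (rule norm_cauchy_schwarz)
  finally have "(1 + \<gamma> * \<alpha>) * norm (p - q) \<le> norm (x - y)"
    by (cases "norm (p - q) = 0") (auto simp: power2_eq_square mult.assoc[symmetric])
  then show ?thesis using \<gamma>(2) by (simp add: pos_le_divide_eq mult.commute)
qed

lemma prox_set_eq_Prox:
  fixes f :: "'a::{real_inner, complete_space} \<Rightarrow> ereal"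
  assumes "proper_fun f" "lsc_fun f" "alpha_convex \<alpha> f" "\<gamma> > 0" "1 + \<gamma> * \<alpha> > 0"
  shows "prox_set \<gamma> f x = {Prox \<gamma> f x}"
proof -
  obtain p where p: "p \<in> prox_set \<gamma> f x" using prox_set_nonempty[OF assms] by blast
  have uniq: "q = p" if "q \<in> prox_set \<gamma> f x" for q
  proof -
    note iff = prox_set_iff[OF assms(1,3,4,5)]
    have "norm (q - p) \<le> norm (x - x) / (1 + \<gamma> * \<alpha>)"
      by (rule prox_lipschitz[OF iff[THEN iffD1, OF that] iff[THEN iffD1, OF p] assms(4,5)])
    then show ?thesis by simp
  qed
  have "Prox \<gamma> f x = p" unfolding Prox_def using p uniq by (rule the_equality)
  then show ?thesis using p uniq by blast
qed

section \<open>Smooth convex functions\<close>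

text \<open>Restriction to the line through x and y reduces this to the tangent of a convex function
  of one real variable.\<close>

lemma convex_gradient_inequality:
  fixes h :: "'a::real_inner \<Rightarrow> real"
  assumes grad: "\<And>y. (h has_derivative (\<lambda>v. inner (gh y) v)) (at y)"
    and conv: "convex_on UNIV h"
  shows "h x + inner (gh x) (y - x) \<le> h y"
proof -
  let ?l = "\<lambda>t::real. x + t *\<^sub>R (y - x)"
  have conv': "convex_on UNIV (\<lambda>t. h (?l t))"
  proof (rule convex_onI)
    fix t a b :: real assume "0 < t" "t < 1"
    have "?l ((1 - t) *\<^sub>R a + t *\<^sub>R b) = (1 - t) *\<^sub>R ?l a + t *\<^sub>R ?l b"
      by (simp add: algebra_simps)
    moreover have "h ((1 - t) *\<^sub>R ?l a + t *\<^sub>R ?l b) \<le> (1 - t) * h (?l a) + t * h (?l b)"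
      using convex_onD[OF conv, of t "?l a" "?l b"] \<open>0 < t\<close> \<open>t < 1\<close> by simp
    ultimately show "h (?l ((1 - t) *\<^sub>R a + t *\<^sub>R b)) \<le> (1 - t) * h (?l a) + t * h (?l b)" by simp
  qed simp
  have "((\<lambda>t. h (?l t)) has_derivative (\<lambda>s. inner (gh (?l 0)) (s *\<^sub>R (y - x)))) (at 0)"
    by (rule has_derivative_compose[OF _ grad]) (auto intro!: derivative_eq_intros)
  then have "((\<lambda>t. h (?l t)) has_real_derivative inner (gh x) (y - x)) (at 0)"
    by (simp add: has_field_derivative_def mult.commute[of _ "inner (gh x) (y - x)"])
  then have "inner (gh x) (y - x) * (1 - 0) \<le> h (?l 1) - h (?l 0)"
    by (intro convex_on_imp_above_tangent[OF conv']) auto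
  then show ?thesis by simp
qed

lemma descent_lemma:
  fixes h :: "'a::real_inner \<Rightarrow> real"
  assumes grad: "\<And>y. (h has_derivative (\<lambda>v. inner (gh y) v)) (at y)"
    and lip: "L-lipschitz_on UNIV gh"
  shows "h y \<le> h x + inner (gh x) (y - x) + L / 2 * (norm (y - x))\<^sup>2"
proof -
  define v where "v = y - x"
  let ?l = "\<lambda>t::real. x + t *\<^sub>R v"
  \<comment> \<open>The last term has derivative \<open>L * t * (norm v)\<^sup>2\<close>, exactly
    the Lipschitz bound on the change of slope along the segment.\<close>
  let ?\<psi> = "\<lambda>t. h (?l t) - t * inner (gh x) v - L / 2 * t\<^sup>2 * (norm v)\<^sup>2"
  have hd: "((\<lambda>t. h (?l t)) has_real_derivative inner (gh (?l t)) v) (at t)" for t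
  proof -
    have "((\<lambda>t. h (?l t)) has_derivative (\<lambda>s. inner (gh (?l t)) (s *\<^sub>R v))) (at t)"
      by (rule has_derivative_compose[OF _ grad]) (auto intro!: derivative_eq_intros)
    then show ?thesis
      by (simp add: has_field_derivative_def mult.commute[of _ "inner (gh (?l t)) v"])
  qed
  have "?\<psi> 1 \<le> ?\<psi> 0"
  proof (rule DERIV_nonpos_imp_nonincreasing[where f = ?\<psi>])
    fix t :: real assume t: "0 \<le> t" "t \<le> 1"
    have "(?\<psi> has_real_derivative inner (gh (?l t)) v - inner (gh x) v - L * t * (norm v)\<^sup>2) (at t)"
      by (rule derivative_eq_intros hd refl | simp)+
    moreover have "inner (gh (?l t)) v - inner (gh x) v - L * t * (norm v)\<^sup>2 \<le> 0"
    proof -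
      have "inner (gh (?l t)) v - inner (gh x) v \<le> norm (gh (?l t) - gh x) * norm v"
        by (metis inner_diff_left norm_cauchy_schwarz)
      also have "\<dots> \<le> (L * norm (?l t - x)) * norm v"
        using lipschitz_onD[OF lip, of "?l t" x] by (intro mult_right_mono) (auto simp: dist_norm)
      also have "\<dots> = L * t * (norm v)\<^sup>2" using t by (simp add: power2_eq_square)
      finally show ?thesis by simp
    qed
    ultimately show "\<exists>y. (?\<psi> has_real_derivative y) (at t) \<and> y \<le> 0" by blast
  qed simp
  then show ?thesis by (simp add: v_def)
qed

text \<open>Baillon--Haddad: after subtracting the tangent at x, the function is minimal at x; compare
  this minimum with the value after one gradient step from y.\<close>
lemma Baillon_Haddad:
  fixes h :: "'a::real_inner \<Rightarrow> real"
  assumes grad: "\<And>y. (h has_derivative (\<lambda>v. inner (gh y) v)) (at y)"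
    and conv: "convex_on UNIV h" and lip: "(1 / \<sigma>)-lipschitz_on UNIV gh" and \<sigma>: "\<sigma> > 0"
  shows "\<sigma> * (norm (gh x - gh y))\<^sup>2 \<le> inner (gh x - gh y) (x - y)"
proof -
  have half: "h x + inner (gh x) (y - x) + \<sigma> / 2 * (norm (gh y - gh x))\<^sup>2 \<le> h y" for x y
  proof -
    define w where "w = gh y - gh x"
    \<comment> \<open>Step length \<sigma> minimizes the quadratic upper bound of the descent lemma
      for h minus its tangent at x, whose gradient at y is \<open>w\<close>.\<close>
    define z where "z = y - \<sigma> *\<^sub>R w"
    have "h x + inner (gh x) (z - x) \<le> h z" by (rule convex_gradient_inequality[OF grad conv])
    moreover have "h z \<le> h y + inner (gh y) (z - y) + 1 / \<sigma> / 2 * (norm (z - y))\<^sup>2"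
      by (rule descent_lemma[OF grad lip])
    moreover have "inner (gh x) (z - x) = inner (gh x) (y - x) - \<sigma> * inner (gh x) w"
      by (simp add: z_def inner_diff_right)
    moreover have "inner (gh y) (z - y) = - \<sigma> * inner (gh y) w" by (simp add: z_def)
    moreover have "1 / \<sigma> / 2 * (norm (z - y))\<^sup>2 = \<sigma> / 2 * (norm w)\<^sup>2"
      using \<sigma> by (simp add: z_def power_mult_distrib power2_eq_square)
    moreover have "\<sigma> * inner (gh y) w - \<sigma> * inner (gh x) w = \<sigma> * (norm w)\<^sup>2"
      unfolding right_diff_distrib[symmetric] inner_diff_left[symmetric] w_def[symmetric]
        power2_norm_eq_inner ..
    ultimately show ?thesis unfolding w_def by linarith
  qed
  \<comment> \<open>Adding the two versions of \<open>half\<close>, with x and y exchanged, cancels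
    the values of h.\<close>
  have "inner (gh x) (y - x) = - inner (gh x) (x - y)" by (simp add: inner_diff_right)
  then show ?thesis using half[of x y] half[of y x]
    by (simp add: inner_diff_left norm_minus_commute)
qed

section \<open>Asymptotic centers and nonexpansive iterations\<close>

text \<open>For bounded x and nontrivial F, this is the upper limit of the distances to y along F,
  as a real number. A filter parameter plays the role of passing to subsequences.\<close>

definition asymptotic_radius :: "nat filter \<Rightarrow> (nat \<Rightarrow> 'a::real_normed_vector) \<Rightarrow> 'a \<Rightarrow> real" where
  "asymptotic_radius F x y = Inf {c. eventually (\<lambda>n. norm (x n - y) \<le> c) F}"

context
  fixes F :: "nat filter" and x :: "nat \<Rightarrow> 'a::real_inner" and B :: real
  assumes F: "F \<noteq> bot" and bnd: "\<And>n. norm (x n) \<le> B"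
begin

lemma asymptotic_radius_bound_nonneg:
  "eventually (\<lambda>n. norm (x n - y) \<le> c) F \<Longrightarrow> 0 \<le> c"
  using eventually_happens'[OF F] norm_ge_zero order_trans by metis

lemma asymptotic_radius_le:
  assumes "eventually (\<lambda>n. norm (x n - y) \<le> c) F"
  shows "asymptotic_radius F x y \<le> c"
  unfolding asymptotic_radius_def
proof (rule cInf_lower)
  show "bdd_below {c. eventually (\<lambda>n. norm (x n - y) \<le> c) F}"
    by (rule bdd_belowI[of _ 0]) (use asymptotic_radius_bound_nonneg in blast)
qed (use assms in simp)

lemma asymptotic_radius_set_nonempty: "{c. eventually (\<lambda>n. norm (x n - y) \<le> c) F} \<noteq> {}"
proof -
  have "norm (x n - y) \<le> B + norm y" for n
    using norm_triangle_ineq4[of "x n" y] bnd[of n] by linarith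
  then show ?thesis by (auto intro: always_eventually)
qed

lemma asymptotic_radius_nonneg: "0 \<le> asymptotic_radius F x y"
  unfolding asymptotic_radius_def
  by (rule cInf_greatest[OF asymptotic_radius_set_nonempty])
    (use asymptotic_radius_bound_nonneg in blast)

lemma asymptotic_radius_eventually:
  assumes "e > 0"
  shows "eventually (\<lambda>n. norm (x n - y) \<le> asymptotic_radius F x y + e) F"
proof -
  have "Inf {c. eventually (\<lambda>n. norm (x n - y) \<le> c) F} < asymptotic_radius F x y + e"
    using assms by (simp add: asymptotic_radius_def)
  from cInf_lessD[OF asymptotic_radius_set_nonempty this] obtain c
    where "eventually (\<lambda>n. norm (x n - y) \<le> c) F" "c < asymptotic_radius F x y + e" by blast
  then show ?thesis by (auto elim!: eventually_mono)
qed

lemma asymptotic_radius_eq_lim: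
  assumes "((\<lambda>n. norm (x n - y)) \<longlongrightarrow> l) F"
  shows "asymptotic_radius F x y = l"
proof (rule antisym)
  show "asymptotic_radius F x y \<le> l"
  proof (rule field_le_epsilon)
    fix e :: real assume "e > 0"
    then have "eventually (\<lambda>n. norm (x n - y) < l + e) F"
      by (intro order_tendstoD(2)[OF assms]) simp
    then show "asymptotic_radius F x y \<le> l + e"
      by (intro asymptotic_radius_le) (auto elim!: eventually_mono)
  qed
  show "l \<le> asymptotic_radius F x y"
    by (rule field_le_epsilon, rule tendsto_upperbound[OF assms asymptotic_radius_eventually F])
qed

text \<open>Applied in both directions, this makes the radius 1-Lipschitz in its center, which
  supplies the semicontinuity needed for a minimizer.\<close>

lemma asymptotic_radius_triangle:
  "asymptotic_radius F x z \<le> asymptotic_radius F x y + norm (y - z)"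
proof (rule field_le_epsilon)
  fix e :: real assume "e > 0"
  from asymptotic_radius_eventually[OF this, of y]
  have "eventually (\<lambda>n. norm (x n - z) \<le> asymptotic_radius F x y + norm (y - z) + e) F"
  proof eventually_elim
    case (elim n)
    then show ?case using norm_triangle_ineq[of "x n - y" "y - z"] by simp
  qed
  then show "asymptotic_radius F x z \<le> asymptotic_radius F x y + norm (y - z) + e"
    by (rule asymptotic_radius_le)
qed

text \<open>The parallelogram identity holds for each \<open>x n\<close>, with the same term in y -
  z, so it passes to the upper limits as an inequality. This uniform convexity gives both existence
  and uniqueness of the center.\<close>

lemma asymptotic_radius_midpoint:
  "(asymptotic_radius F x ((1/2) *\<^sub>R (y + z)))\<^sup>2 + 1/4 * (norm (y - z))\<^sup>2
    \<le> ((asymptotic_radius F x y)\<^sup>2 + (asymptotic_radius F x z)\<^sup>2) / 2"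
proof -
  let ?r = "asymptotic_radius F x"
  define m where "m = (1/2) *\<^sub>R (y + z)"
  let ?Q = "\<lambda>e. ((?r y + e)\<^sup>2 + (?r z + e)\<^sup>2) / 2 - 1/4 * (norm (y - z))\<^sup>2"
  have le: "(?r m)\<^sup>2 \<le> ?Q e" if "e > 0" for e
  proof -
    have ev: "eventually (\<lambda>n. (norm (x n - m))\<^sup>2 \<le> ?Q e) F"
      using asymptotic_radius_eventually[OF that, of y] asymptotic_radius_eventually[OF that, of z]
    proof eventually_elim
      case (elim n)
      have "(norm (x n - m))\<^sup>2 = ((norm (x n - y))\<^sup>2 + (norm (x n - z))\<^sup>2) / 2 - 1/4 * (norm (y - z))\<^sup>2"
        unfolding power2_norm_eq_inner m_def
        by (simp add: inner_diff_left inner_diff_right inner_add_left inner_add_right inner_commute field_simps)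
      moreover have "(norm (x n - y))\<^sup>2 \<le> (?r y + e)\<^sup>2" "(norm (x n - z))\<^sup>2 \<le> (?r z + e)\<^sup>2"
        using elim by (auto intro!: power_mono)
      ultimately show ?case by argo
    qed
    \<comment> \<open>Nonnegativity allows the square root to be squared back; it follows from a
      single index, which exists because F is nontrivial.\<close>
    have "0 \<le> ?Q e" using eventually_happens'[OF F ev] by (metis order_trans zero_le_power2)
    have "?r m \<le> sqrt (?Q e)"
      by (rule asymptotic_radius_le) (use ev in \<open>auto elim!: eventually_mono intro: real_le_rsqrt\<close>)
    then have "(?r m)\<^sup>2 \<le> (sqrt (?Q e))\<^sup>2" using asymptotic_radius_nonneg by (intro power_mono)
    then show ?thesis using \<open>0 \<le> ?Q e\<close> by simp
  qed
  have "(?Q \<longlongrightarrow> ?Q 0) (at_right 0)" by (intro tendsto_intros) auto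
  moreover have "eventually (\<lambda>e. (?r m)\<^sup>2 \<le> ?Q e) (at_right 0)"
    using le by (auto simp: eventually_at_filter)
  ultimately have "(?r m)\<^sup>2 \<le> ?Q 0" by (rule tendsto_lowerbound) simp
  then have "(?r m)\<^sup>2 \<le> ((?r y)\<^sup>2 + (?r z)\<^sup>2) / 2 - 1/4 * (norm (y - z))\<^sup>2" by simp
  then show ?thesis unfolding m_def by argo
qed

text \<open>A second minimizer would make the midpoint strictly better. Only comparison with c is
  asked of c', so that a map not increasing the radius is seen to fix the center.\<close>

lemma asymptotic_center_unique:
  assumes "\<And>w. asymptotic_radius F x c \<le> asymptotic_radius F x w"
    and "asymptotic_radius F x c' \<le> asymptotic_radius F x c"
  shows "c' = c"
proof -
  let ?r = "asymptotic_radius F x"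
  define m where "m = (1/2) *\<^sub>R (c + c')"
  have "(?r c)\<^sup>2 \<le> (?r m)\<^sup>2"
    by (rule power_mono[OF assms(1) asymptotic_radius_nonneg])
  moreover have "(?r c')\<^sup>2 \<le> (?r c)\<^sup>2" by (rule power_mono[OF assms(2) asymptotic_radius_nonneg])
  ultimately have "(norm (c - c'))\<^sup>2 \<le> 0"
    using asymptotic_radius_midpoint[of c c', folded m_def] by argo
  then show ?thesis by simp
qed

end


lemma asymptotic_center_exists:
  fixes x :: "nat \<Rightarrow> 'a::{real_inner, complete_space}"
  assumes F: "F \<noteq> bot" and bnd: "\<And>n. norm (x n) \<le> B"
  shows "\<exists>c. \<forall>w. asymptotic_radius F x c \<le> asymptotic_radius F x w"
proof -
  let ?r = "asymptotic_radius F x"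
  note nonneg = asymptotic_radius_nonneg[OF F bnd]
  have "\<exists>c\<in>UNIV. \<forall>w\<in>UNIV. (?r c)\<^sup>2 \<le> (?r w)\<^sup>2"
  proof (rule strongly_convex_minimizer[where \<mu> = "1/4" and m = 0])
    fix y z :: 'a
    show "(1/2) *\<^sub>R (y + z) \<in> UNIV \<and> (?r ((1/2) *\<^sub>R (y + z)))\<^sup>2 + 1/4 * (norm (y - z))\<^sup>2
        \<le> ((?r y)\<^sup>2 + (?r z)\<^sup>2) / 2"
      using asymptotic_radius_midpoint[where x = x, OF F bnd] by blast
  next
    fix s z l assume s: "s \<longlonglongrightarrow> z" "(\<lambda>n. (?r (s n))\<^sup>2) \<longlonglongrightarrow> l"
    have le: "norm (?r (s n) - ?r z) \<le> norm (s n - z)" for n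
      using asymptotic_radius_triangle[where x = x and y = z and z = "s n", OF F bnd]
        asymptotic_radius_triangle[where x = x and y = "s n" and z = z, OF F bnd]
      by (simp add: norm_minus_commute)
    have "(\<lambda>n. norm (s n - z)) \<longlonglongrightarrow> 0" using s(1) by (simp add: LIM_zero_iff tendsto_norm_zero_iff)
    then have "(\<lambda>n. ?r (s n) - ?r z) \<longlonglongrightarrow> 0"
      by (rule Lim_null_comparison[OF always_eventually, rotated]) (use le in blast)
    then have "(\<lambda>n. ?r (s n)) \<longlonglongrightarrow> ?r z" by (simp add: LIM_zero_iff)
    then have "(\<lambda>n. (?r (s n))\<^sup>2) \<longlonglongrightarrow> (?r z)\<^sup>2" by (intro tendsto_intros)
    then have "(?r z)\<^sup>2 = l" using s(2) LIMSEQ_unique by blast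
    then show "z \<in> UNIV \<and> (?r z)\<^sup>2 \<le> l" by simp
  qed auto
  then show ?thesis using nonneg by (meson UNIV_I power2_le_imp_le)
qed

text \<open>A minimiser of the asymptotic radius is a fixed point; along every filter finer than
  the sequential one the minimiser has to be the same, because distances to fixed points converge. No weak compactness is needed.\<close>
lemma nonexpansive_iterates_weakly_converge:
  fixes T :: "'a::{real_inner, complete_space} \<Rightarrow> 'a"
  assumes T: "nonexpansive T" and iter: "\<And>n. x (Suc n) = T (x n)" and z: "T z = z"
    and reg: "(\<lambda>n. norm (x n - T (x n))) \<longlonglongrightarrow> 0"
  shows "\<exists>c. weakly_converges x c \<and> T c = c"
proof -
  have fejer: "norm (x (Suc n) - w) \<le> norm (x n - w)" if "T w = w" for n w
    using T that unfolding nonexpansive_def iter by metis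
  have dist_conv: "\<exists>l. (\<lambda>n. norm (x n - w)) \<longlonglongrightarrow> l" if "T w = w" for w
  proof -
    have "decseq (\<lambda>n. norm (x n - w))" using fejer[OF that] by (rule decseq_SucI)
    then show ?thesis using decseq_convergent[of "\<lambda>n. norm (x n - w)" 0] by (metis norm_ge_zero)
  qed
  have "norm (x n - z) \<le> norm (x 0 - z)" for n
    by (induction n) (use fejer[OF z] order_trans in blast)+
  then have bnd: "norm (x n) \<le> norm (x 0 - z) + norm z" for n
    using norm_triangle_ineq[of "x n - z" z] by (smt (verit) diff_add_cancel)
  \<comment> \<open>Since \<open>x n - T (x n)\<close> vanishes and T is nonexpansive, T c is
    asymptotically no farther from the sequence than c.\<close>
  have center_fix: "T c = c" if F: "F \<noteq> bot" "F \<le> sequentially"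
    and c: "\<And>w. asymptotic_radius F x c \<le> asymptotic_radius F x w" for F c
  proof (rule asymptotic_center_unique[OF F(1) bnd c])
    show "asymptotic_radius F x (T c) \<le> asymptotic_radius F x c"
    proof (rule field_le_epsilon)
      fix e :: real assume e: "e > 0"
      have "eventually (\<lambda>n. norm (x n - T (x n)) < e / 2) F"
        using order_tendstoD(2)[OF tendsto_mono[OF F(2) reg], of "e / 2"] e by simp
      moreover have "eventually (\<lambda>n. norm (x n - c) \<le> asymptotic_radius F x c + e / 2) F"
        using e by (intro asymptotic_radius_eventually[OF F(1) bnd]) simp
      ultimately have "eventually (\<lambda>n. norm (x n - T c) \<le> asymptotic_radius F x c + e) F"
      proof eventually_elim
        case (elim n)
        have "norm (x n - T c) \<le> norm (x n - T (x n)) + norm (T (x n) - T c)"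
          using norm_triangle_ineq[of "x n - T (x n)" "T (x n) - T c"] by simp
        moreover have "norm (T (x n) - T c) \<le> norm (x n - c)" using T by (simp add: nonexpansive_def)
        ultimately show ?case using elim by linarith
      qed
      then show "asymptotic_radius F x (T c) \<le> asymptotic_radius F x c + e"
        by (rule asymptotic_radius_le[OF F(1) bnd])
    qed
  qed
  obtain c where c: "\<And>w. asymptotic_radius sequentially x c \<le> asymptotic_radius sequentially x w"
    using asymptotic_center_exists[where x = x, OF sequentially_bot bnd] by blast
  have Tc: "T c = c" using center_fix[OF sequentially_bot order_refl c] .
  obtain l where l: "(\<lambda>n. norm (x n - c)) \<longlonglongrightarrow> l" using dist_conv[OF Tc] by blast
  have l_eq: "asymptotic_radius sequentially x c = l"
    by (rule asymptotic_radius_eq_lim[OF sequentially_bot bnd l])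
  have half: "eventually (\<lambda>n. inner (x n - c) y < e) sequentially" if e: "e > 0" for y e
  proof (rule ccontr)
    assume neg: "\<not> eventually (\<lambda>n. inner (x n - c) y < e) sequentially"
    \<comment> \<open>This filter replaces a subsequence on which the products stay at least e; it
      is nontrivial because such n occur infinitely often.\<close>
    define F where "F = inf sequentially (principal {n. e \<le> inner (x n - c) y})"
    have F: "F \<noteq> bot" "F \<le> sequentially"
      using neg by (auto simp: F_def trivial_limit_def eventually_inf_principal not_le)
    have ev: "eventually (\<lambda>n. e \<le> inner (x n - c) y) F"
      by (simp add: F_def eventually_inf_principal)
    have "y \<noteq> 0" using eventually_happens'[OF F(1) ev] e by auto
    then have y: "inner y y > 0" by simp
    \<comment> \<open>This t minimizes \<open>- 2 * t * e + t * (t * inner y y)\<close>; moving c by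
      t y then lowers the squared distances along F by at least \<open>t * e\<close>.\<close>
    define t where "t = e / inner y y"
    have t: "t > 0" "t * inner y y = e" using e y by (auto simp: t_def)
    obtain c' where c': "\<And>w. asymptotic_radius F x c' \<le> asymptotic_radius F x w"
      using asymptotic_center_exists[where x = x, OF F(1) bnd] by blast
    obtain l' where l': "(\<lambda>n. norm (x n - c')) \<longlonglongrightarrow> l'" using dist_conv[OF center_fix[OF F c']] by blast
    \<comment> \<open>The distances to the fixed point c' converge, so its radius is the same along
      F and along the full sequence. Optimality of c thus carries over to F, where moving towards y
      would improve on it.\<close>
    have "l \<le> asymptotic_radius sequentially x c'" using c[of c'] l_eq by simp
    also have "\<dots> = l'" by (rule asymptotic_radius_eq_lim[OF sequentially_bot bnd l'])
    also have "\<dots> = asymptotic_radius F x c'"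
      using asymptotic_radius_eq_lim[OF F(1) bnd tendsto_mono[OF F(2) l']] ..
    also have "\<dots> \<le> asymptotic_radius F x (c + t *\<^sub>R y)" by (rule c')
    finally have le: "l \<le> asymptotic_radius F x (c + t *\<^sub>R y)" .
    have l0: "0 \<le> l"
      using asymptotic_radius_nonneg[where x = x and y = c, OF sequentially_bot bnd] l_eq by simp
    have ev2: "eventually (\<lambda>n. (norm (x n - (c + t *\<^sub>R y)))\<^sup>2 \<le> (norm (x n - c))\<^sup>2 - t * e) F"
      using ev
    proof eventually_elim
      case (elim n)
      have "(norm (x n - (c + t *\<^sub>R y)))\<^sup>2 = (norm (x n - c))\<^sup>2 - 2 * t * inner (x n - c) y + t * (t * inner y y)"
        unfolding power2_norm_eq_inner
        by (simp add: inner_diff_left inner_diff_right inner_add_left inner_add_right inner_commute algebra_simps)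
      moreover have "t * e \<le> t * inner (x n - c) y" using elim t by simp
      ultimately show ?case unfolding t(2) by linarith
    qed
    have "eventually (\<lambda>n. (norm (x n - c))\<^sup>2 < l\<^sup>2 + t * e / 2) F"
      by (rule order_tendstoD(2)[OF tendsto_power[OF tendsto_mono[OF F(2) l]]]) (use t e in simp)
    with ev2 have ev3: "eventually (\<lambda>n. (norm (x n - (c + t *\<^sub>R y)))\<^sup>2 \<le> l\<^sup>2 - t * e / 2) F"
      by eventually_elim simp
    have "asymptotic_radius F x (c + t *\<^sub>R y) \<le> sqrt (l\<^sup>2 - t * e / 2)"
      by (rule asymptotic_radius_le[OF F(1) bnd]) (use ev3 in \<open>auto elim!: eventually_mono intro: real_le_rsqrt\<close>)
    then have "l \<le> sqrt (l\<^sup>2 - t * e / 2)" using le by simp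
    also have "\<dots> < sqrt (l\<^sup>2)" using t e by (intro real_sqrt_less_mono) simp
    finally show False using l0 by simp
  qed
  have "(\<lambda>n. inner (x n) y) \<longlonglongrightarrow> inner c y" for y
  proof (rule tendstoI)
    fix e :: real assume e: "e > 0"
    show "eventually (\<lambda>n. dist (inner (x n) y) (inner c y) < e) sequentially"
      using half[OF e, of y] half[OF e, of "- y"]
      by eventually_elim (simp add: dist_real_def inner_diff_left abs_less_iff)
  qed
  then show ?thesis using Tc by (auto simp: weakly_converges_def)
qed

text \<open>The block from n div 2 to n has at least n/2 terms, each at least \<open>a n\<close>,
  and its sum is a Cauchy tail.\<close>

lemma decreasing_summable_imp_smallo:
  fixes a :: "nat \<Rightarrow> real"
  assumes dec: "\<And>n. a (Suc n) \<le> a n" and nonneg: "\<And>n. 0 \<le> a n" and sum: "summable a"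
  shows "(\<lambda>n. real n * a n) \<longlonglongrightarrow> 0"
proof (rule tendstoI)
  fix e :: real assume e: "e > 0"
  have mono: "a n \<le> a m" if "m \<le> n" for m n
    using lift_Suc_antimono_le[of a, OF dec that] .
  obtain N where N: "\<And>m n. m \<ge> N \<Longrightarrow> norm (sum a {m..<n}) < e / 2"
    using sum e unfolding summable_Cauchy by (metis half_gt_zero)
  \<comment> \<open>The threshold ensures n div 2 \<ge> N; the factor 2 lost by keeping half of the
    indices is paid by e / 2.\<close>
  have "dist (real n * a n) 0 < e" if n: "n \<ge> 2 * N + 1" for n
  proof -
    have "real n * a n \<le> 2 * (real (n - n div 2) * a n)"
      using nonneg[of n] by (auto simp: mult.assoc[symmetric] intro!: mult_right_mono)
    also have "real (n - n div 2) * a n = (\<Sum>k\<in>{n div 2..<n}. a n)" by simp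
    also have "\<dots> \<le> sum a {n div 2..<n}" by (intro sum_mono mono) simp
    also have "\<dots> < e / 2" using N[of "n div 2" n] n by (simp add: sum_nonneg nonneg)
    finally show ?thesis using nonneg[of n] by (simp add: dist_real_def)
  qed
  then show "eventually (\<lambda>n. dist (real n * a n) 0 < e) sequentially"
    unfolding eventually_sequentially by blast
qed

lemma smallo_inverse_sqrt:
  assumes "(\<lambda>n. real n * (b n)\<^sup>2) \<longlonglongrightarrow> 0" and "\<And>n. 0 \<le> b n"
  shows "b \<in> o(\<lambda>n. 1 / sqrt (real n))"
proof (rule smalloI_tendsto)
  have "(\<lambda>n. sqrt (real n * (b n)\<^sup>2)) \<longlonglongrightarrow> sqrt 0" using assms(1) by (rule tendsto_real_sqrt)
  then show "(\<lambda>n. b n / (1 / sqrt (real n))) \<longlonglongrightarrow> 0"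
    using assms(2) by (simp add: real_sqrt_mult mult.commute)
  \<comment> \<open>At n = 0 the comparison function is 0 because division by zero yields 0.\<close>
  show "eventually (\<lambda>n. 1 / sqrt (real n) \<noteq> 0) sequentially"
    using eventually_gt_at_top[of 0] by eventually_elim simp
qed

text \<open>Telescoping makes the squared residuals summable, and nonexpansiveness makes them
  decrease; together these give the little-o rate.\<close>

lemma averaged_iterates_asymptotically_regular:
  fixes T :: "'a::real_normed_vector \<Rightarrow> 'a"
  assumes T: "nonexpansive T" and iter: "\<And>n. x (Suc n) = T (x n)" and "k > 0"
    and avg: "\<And>y. (norm (T y - z))\<^sup>2 + k * (norm (y - T y))\<^sup>2 \<le> (norm (y - z))\<^sup>2"
  shows "(\<lambda>n. norm (x n - T (x n))) \<in> o(\<lambda>n. 1 / sqrt (real n))"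
    and "(\<lambda>n. norm (x n - T (x n))) \<longlonglongrightarrow> 0"
proof -
  let ?a = "\<lambda>n. (norm (x n - T (x n)))\<^sup>2"
  have "(\<Sum>i<n. k * ?a i) \<le> (norm (x 0 - z))\<^sup>2 - (norm (x n - z))\<^sup>2" for n
  proof (induction n)
    case (Suc n)
    then show ?case using avg[of "x n"] by (simp add: iter)
  qed simp
  then have "(\<Sum>i<n. k * ?a i) \<le> (norm (x 0 - z))\<^sup>2" for n
    by (rule order_trans) simp
  then have "summable (\<lambda>n. k * ?a n)" using \<open>k > 0\<close> by (intro summableI_nonneg_bounded) auto
  then have sum: "summable ?a" using \<open>k > 0\<close> by (simp add: summable_cmult_iff)
  have dec: "?a (Suc n) \<le> ?a n" for n
    unfolding iter using T by (intro power_mono) (auto simp: nonexpansive_def iter)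
  show "(\<lambda>n. norm (x n - T (x n))) \<in> o(\<lambda>n. 1 / sqrt (real n))"
    by (rule smallo_inverse_sqrt[OF decreasing_summable_imp_smallo[OF dec _ sum]]) auto
  have "(\<lambda>n. sqrt (?a n)) \<longlonglongrightarrow> sqrt 0" using summable_LIMSEQ_zero[OF sum] by (rule tendsto_real_sqrt)
  then show "(\<lambda>n. norm (x n - T (x n))) \<longlonglongrightarrow> 0" by simp
qed

lemma inner_bounded_null_tendsto:
  fixes a d :: "nat \<Rightarrow> 'a::real_inner"
  assumes "\<And>n. norm (a n) \<le> B" and "d \<longlonglongrightarrow> 0"
  shows "(\<lambda>n. inner (a n) (d n)) \<longlonglongrightarrow> 0"
proof (rule Lim_null_comparison)
  have "norm (inner (a n) (d n)) \<le> B * norm (d n)" for n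
    using Cauchy_Schwarz_ineq2[of "a n" "d n"] mult_right_mono[OF assms(1) norm_ge_zero] order_trans
    by (metis real_norm_def)
  then show "eventually (\<lambda>n. norm (inner (a n) (d n)) \<le> B * norm (d n)) sequentially" by simp
  show "(\<lambda>n. B * norm (d n)) \<longlonglongrightarrow> 0"
    using tendsto_mult_right_zero[OF tendsto_norm_zero[OF assms(2)]] .
qed

section \<open>The splitting operator\<close>

text \<open>All vectors are differences belonging to two inputs: \<open>X\<close> of the inputs,
  \<open>P\<close> and \<open>Q\<close> of the proximal points, \<open>U\<close> and
  \<open>V\<close> of the subgradients of f and g, \<open>C\<close> of the gradients of h. In the
  sum of the monotonicity inequalities \<open>inner U P\<close> cancels, and
  \<open>inner U (P - Q)\<close> is recovered from \<open>inner X (P - Q)\<close>.\<close>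

lemma splitting_inequality:
  fixes X P Q U V C :: "'a::real_inner"
  assumes "\<alpha> * (norm P)\<^sup>2 \<le> inner U P" and "\<beta> * (norm Q)\<^sup>2 \<le> inner V Q"
    and X: "X = P + \<gamma> *\<^sub>R U" and V: "V = (1 / \<delta>) *\<^sub>R (P - Q) - U - C" and \<gamma>: "\<gamma> > 0"
  shows "(1 - \<gamma> / \<delta> - 2 * \<beta> * \<gamma>) * inner P (P - Q) + \<gamma> * (\<alpha> + \<beta>) * (norm P)\<^sup>2
      + \<gamma> * (1 / \<delta> + \<beta>) * (norm (P - Q))\<^sup>2 + \<gamma> * inner C P - \<gamma> * inner C (P - Q) \<le> inner X (P - Q)"
proof -
  define D where "D = P - Q"
  have Q: "Q = P - D" by (simp add: D_def)
  have "inner V Q = inner P D / \<delta> - (norm D)\<^sup>2 / \<delta> - inner U P + inner U D - inner C P + inner C D"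
    unfolding V D_def[symmetric] unfolding Q power2_norm_eq_inner
    by (simp add: inner_diff_left inner_diff_right inner_commute diff_divide_distrib)
  moreover have "(norm Q)\<^sup>2 = (norm P)\<^sup>2 - 2 * inner P D + (norm D)\<^sup>2"
    unfolding Q power2_norm_eq_inner by (simp add: inner_diff_left inner_diff_right inner_commute)
  ultimately have "\<alpha> * (norm P)\<^sup>2 + \<beta> * ((norm P)\<^sup>2 - 2 * inner P D + (norm D)\<^sup>2)
      - inner P D / \<delta> + (norm D)\<^sup>2 / \<delta> + inner C P - inner C D \<le> inner U D"
    using assms(1,2) by simp
  from mult_left_mono[OF this, of \<gamma>] \<gamma>
  have "\<gamma> * (\<alpha> * (norm P)\<^sup>2 + \<beta> * ((norm P)\<^sup>2 - 2 * inner P D + (norm D)\<^sup>2)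
      - inner P D / \<delta> + (norm D)\<^sup>2 / \<delta> + inner C P - inner C D) \<le> \<gamma> * inner U D" by simp
  then show ?thesis unfolding D_def[symmetric] X by (simp add: inner_add_left algebra_simps)
qed

text \<open>Used with a = 1/\<gamma> and a + 2\<alpha> = 1/\<delta>. The moduli \<alpha> and
  -\<alpha> cancel the squares of \<open>P\<close>. The left side collects what is linear in
  \<open>P\<close> and does not involve \<open>D\<close>; each term on the right is small with
  \<open>D\<close> or \<open>K\<close>, pairs \<open>W\<close> with the fixed \<open>E\<close>, or
  is of second order in \<open>E\<close>, \<open>E'\<close>.\<close>

lemma weak_test_inequality:
  fixes P W D E E' K :: "'a::real_inner"
  assumes "\<alpha> * (norm P)\<^sup>2 \<le> inner (a *\<^sub>R (W - P)) P"
    and "- \<alpha> * (norm (P - D - E))\<^sup>2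
      \<le> inner ((a + 2 * \<alpha>) *\<^sub>R D - a *\<^sub>R (W - P) - K - E') (P - D - E)"
  shows "inner P ((a + 2 * \<alpha>) *\<^sub>R E + E') \<le>
      inner (a *\<^sub>R (W - P) + E' - (2 * \<alpha>) *\<^sub>R P + (2 * \<alpha>) *\<^sub>R E + \<alpha> *\<^sub>R D) D
      + inner (P - D - E) ((a + 2 * \<alpha>) *\<^sub>R D - K)
      + a * inner W E + inner E' E + \<alpha> * (norm E)\<^sup>2"
  using add_mono[OF assms] unfolding power2_norm_eq_inner
  by (simp add: inner_diff_left inner_diff_right inner_add_left inner_add_right algebra_simps inner_commute)

text \<open>The last three conditions are what both step-size cases have in common; the formula for
  \<delta> enters only for the weak limit of p, and \<eta>s only through the cocoercivity
  constant.\<close>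

locale three_operator_splitting =
  fixes f g :: "'a::{real_inner, complete_space} \<Rightarrow> ereal"
    and h :: "'a \<Rightarrow> real" and gh :: "'a \<Rightarrow> 'a"
    and \<alpha> \<beta> \<sigma> \<gamma> \<delta> :: real
  assumes f: "proper_fun f" "lsc_fun f" "alpha_convex \<alpha> f"
    and g: "proper_fun g" "lsc_fun g" "alpha_convex \<beta> g"
    and h_grad: "\<And>y. (h has_derivative (\<lambda>v. inner (gh y) v)) (at y)"
    and h_convex: "convex_on UNIV h"
    and \<sigma>: "\<sigma> > 0" and gh_lip: "(1 / \<sigma>)-lipschitz_on UNIV gh"
    and \<gamma>: "\<gamma> > 0" and \<delta>: "\<delta> > 0"
    and \<gamma>\<alpha>: "1 + \<gamma> * \<alpha> > 0" and \<delta>\<beta>: "1 + \<delta> * \<beta> > 0" and \<alpha>\<beta>: "\<alpha> + \<beta> \<ge> 0"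
begin

abbreviation p where "p y \<equiv> Prox \<gamma> f y"
abbreviation q where "q y \<equiv> Prox \<delta> g (S_op \<gamma> \<delta> f gh y)"
text \<open>\<open>u y\<close> and \<open>v y\<close> are the subgradients of f at
  \<open>p y\<close> and of g at \<open>q y\<close> that the two prox steps select. Their sum with
  \<open>gh (p y)\<close> is (p y - q y)/\<delta>, so p y = q y makes p y a zero of the sum.\<close>

abbreviation u where "u y \<equiv> (1 / \<gamma>) *\<^sub>R (y - p y)"
abbreviation v where "v y \<equiv> (1 / \<delta>) *\<^sub>R (p y - q y) - u y - gh (p y)"

lemmas prox_f = prox_set_eq_Prox[OF f \<gamma> \<gamma>\<alpha>]
lemmas prox_g = prox_set_eq_Prox[OF g \<delta> \<delta>\<beta>]

lemma subgradient_prox_f: "alpha_subgradient \<alpha> f (p y) (u y)"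
  using prox_set_iff[OF f(1,3) \<gamma> \<gamma>\<alpha>] prox_f[of y] by blast

lemma subgradient_prox_g: "alpha_subgradient \<beta> g (Prox \<delta> g y) ((1 / \<delta>) *\<^sub>R (y - Prox \<delta> g y))"
  using prox_set_iff[OF g(1,3) \<delta> \<delta>\<beta>] prox_g[of y] by blast

text \<open>The weight 1 + \<delta>/\<gamma> is what turns S into an explicit step of length
  \<delta> from p y along the negative of \<open>u y + gh (p y)\<close>.\<close>

lemma S_op_eq: "S_op \<gamma> \<delta> f gh y = p y - \<delta> *\<^sub>R (u y + gh (p y))"
  using \<gamma> by (simp add: S_op_def Let_def algebra_simps)

lemma subgradient_q: "alpha_subgradient \<beta> g (q y) (v y)"
proof -
  have "(1 / \<delta>) *\<^sub>R (S_op \<gamma> \<delta> f gh y - q y) = v y"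
    using \<delta> by (subst S_op_eq) (simp add: scaleR_right_diff_distrib scaleR_right_distrib algebra_simps)
  then show ?thesis using subgradient_prox_g[of "S_op \<gamma> \<delta> f gh y"] by simp
qed

lemma Prox_eqI_f: "alpha_subgradient \<alpha> f z ((1 / \<gamma>) *\<^sub>R (y - z)) \<Longrightarrow> p y = z"
  using prox_set_iff[OF f(1,3) \<gamma> \<gamma>\<alpha>] prox_f[of y] by (metis singletonD)

lemma Prox_eqI_g: "alpha_subgradient \<beta> g z ((1 / \<delta>) *\<^sub>R (y - z)) \<Longrightarrow> Prox \<delta> g y = z"
  using prox_set_iff[OF g(1,3) \<delta> \<delta>\<beta>] prox_g[of y] by (metis singletonD)

lemma T_set_eq: "T_set \<gamma> \<delta> \<eta> f g gh y = {T_op \<gamma> \<delta> \<eta> f g gh y}"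
  unfolding T_set_def T_op_def S_op_def Let_def by (auto simp: prox_f prox_g)

text \<open>The squares of \<open>P\<close> and \<open>C\<close> are kept: completing them gives
  cocoercivity, while letting \<open>D\<close> vanish or tend to 0 gives uniqueness and strong
  limits.\<close>

lemma splitting_estimate:
  fixes y z :: 'a
  defines "P \<equiv> p y - p z" and "D \<equiv> (p y - q y) - (p z - q z)" and "C \<equiv> gh (p y) - gh (p z)"
  shows "(1 - \<gamma> / \<delta> - 2 * \<beta> * \<gamma>) * inner P D + \<gamma> * (\<alpha> + \<beta>) * (norm P)\<^sup>2
      + \<gamma> * (1 / \<delta> + \<beta>) * (norm D)\<^sup>2 + \<gamma> * \<sigma> * (norm C)\<^sup>2 - \<gamma> * inner C D \<le> inner (y - z) D"
proof -
  have D: "D = P - (q y - q z)" by (simp add: D_def P_def)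
  have "(1 - \<gamma> / \<delta> - 2 * \<beta> * \<gamma>) * inner P D + \<gamma> * (\<alpha> + \<beta>) * (norm P)\<^sup>2
      + \<gamma> * (1 / \<delta> + \<beta>) * (norm D)\<^sup>2 + \<gamma> * inner C P - \<gamma> * inner C D \<le> inner (y - z) D"
    unfolding D
  proof (rule splitting_inequality[OF _ _ _ _ \<gamma>])
    show "\<alpha> * (norm P)\<^sup>2 \<le> inner (u y - u z) P"
      unfolding P_def by (rule alpha_subgradient_monotone[OF subgradient_prox_f subgradient_prox_f])
    show "\<beta> * (norm (q y - q z))\<^sup>2 \<le> inner (v y - v z) (q y - q z)"
      by (rule alpha_subgradient_monotone[OF subgradient_q subgradient_q])
    show "y - z = P + \<gamma> *\<^sub>R (u y - u z)" using \<gamma> by (simp add: P_def algebra_simps)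
    show "v y - v z = (1 / \<delta>) *\<^sub>R (P - (q y - q z)) - (u y - u z) - C"
      by (simp add: P_def C_def scaleR_right_diff_distrib)
  qed
  moreover have "\<gamma> * (\<sigma> * (norm C)\<^sup>2) \<le> \<gamma> * inner C P"
    unfolding P_def C_def using Baillon_Haddad[OF h_grad h_convex gh_lip \<sigma>] \<gamma>
    by (intro mult_left_mono) auto
  ultimately show ?thesis by (simp add: mult.assoc)
qed

lemma coincidence_unique:
  assumes "p y = q y" "p z = q z"
  shows "gh (p y) = gh (p z)" and "\<alpha> + \<beta> > 0 \<Longrightarrow> p y = p z"
proof -
  have "\<gamma> * (\<alpha> + \<beta>) * (norm (p y - p z))\<^sup>2 + \<gamma> * \<sigma> * (norm (gh (p y) - gh (p z)))\<^sup>2 \<le> 0"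
    using splitting_estimate[of y z] assms by simp
  moreover have a: "0 \<le> \<gamma> * (\<alpha> + \<beta>) * (norm (p y - p z))\<^sup>2" using \<gamma> \<alpha>\<beta> by simp
  moreover have b: "0 \<le> \<gamma> * \<sigma> * (norm (gh (p y) - gh (p z)))\<^sup>2" using \<gamma> \<sigma> by simp
  ultimately have "\<gamma> * (\<alpha> + \<beta>) * (norm (p y - p z))\<^sup>2 = 0" "\<gamma> * \<sigma> * (norm (gh (p y) - gh (p z)))\<^sup>2 = 0"
    by linarith+
  then show "gh (p y) = gh (p z)" and "\<alpha> + \<beta> > 0 \<Longrightarrow> p y = p z" using \<gamma> \<sigma> by auto
qed

text \<open>Zeros of the sum are encoded by inputs at which the two proximal points coincide, which
  for \<eta> > 0 are the fixed points of the iteration.\<close>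

lemma zer_sum_iff: "z \<in> zer_sum f g gh \<longleftrightarrow> (\<exists>y. p y = z \<and> q y = z)"
proof
  assume "z \<in> zer_sum f g gh"
  then obtain a b where ab: "alpha_subgradient \<alpha> f z a" "alpha_subgradient \<beta> g z b" "a + b + gh z = 0"
    unfolding zer_sum_def using frechet_subdiff_iff[OF f(1,3)] frechet_subdiff_iff[OF g(1,3)] by blast
  \<comment> \<open>The input for which the first prox step returns z and selects exactly the
    subgradient a.\<close>
  define y where "y = z + \<gamma> *\<^sub>R a"
  have py: "p y = z" by (rule Prox_eqI_f) (use ab(1) \<gamma> in \<open>simp add: y_def\<close>)
  have u: "u y = a" using py \<gamma> by (simp add: y_def)
  have b: "b = - (a + gh z)" using ab(3) by (simp add: eq_neg_iff_add_eq_0 algebra_simps)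
  have "S_op \<gamma> \<delta> f gh y - z = \<delta> *\<^sub>R b" unfolding S_op_eq u unfolding py b by (simp add: algebra_simps)
  then have "q y = z" using ab(2) \<delta> by (intro Prox_eqI_g) simp
  then show "\<exists>y. p y = z \<and> q y = z" using py by blast
next
  assume "\<exists>y. p y = z \<and> q y = z"
  then obtain y where y: "p y = z" "q y = z" by blast
  have "u y \<in> frechet_subdiff f z" "v y \<in> frechet_subdiff g z"
    using subgradient_prox_f[of y] subgradient_q[of y] y
    by (simp_all add: frechet_subdiff_iff[OF f(1,3)] frechet_subdiff_iff[OF g(1,3)])
  moreover have "u y + v y + gh z = 0" using y by simp
  ultimately show "z \<in> zer_sum f g gh" unfolding zer_sum_def by blast
qed

text \<open>In the sum of the three subgradient inequalities the linear terms cancel and the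
  quadratic terms add up to (\<alpha> + \<beta>)/2 times a square, so f + g + h behaves like a
  convex function even if f or g does not.\<close>

lemma zer_sum_subset_argmin: "zer_sum f g gh \<subseteq> argmin_fun (\<lambda>y. f y + g y + ereal (h y))"
proof
  fix z assume "z \<in> zer_sum f g gh"
  then obtain a b where ab: "alpha_subgradient \<alpha> f z a" "alpha_subgradient \<beta> g z b" "a + b + gh z = 0"
    unfolding zer_sum_def using frechet_subdiff_iff[OF f(1,3)] frechet_subdiff_iff[OF g(1,3)] by blast
  have zf: "f z = ereal (real_of_ereal (f z))" and zg: "g z = ereal (real_of_ereal (g z))"
    using ab proper_fun_eq_real[OF f(1), of z] proper_fun_eq_real[OF g(1), of z]
    by (auto simp only: alpha_subgradient_def)
  have "f z + g z + ereal (h z) \<le> f y + g y + ereal (h y)" for y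
  proof (cases "y \<in> edom f \<and> y \<in> edom g")
    case True
    have yf: "f y = ereal (real_of_ereal (f y))" and yg: "g y = ereal (real_of_ereal (g y))"
      using True proper_fun_eq_real[OF f(1), of y] proper_fun_eq_real[OF g(1), of y] by blast+
    have "real_of_ereal (f z) + inner a (y - z) + \<alpha> / 2 * (norm (y - z))\<^sup>2 \<le> real_of_ereal (f y)"
      "real_of_ereal (g z) + inner b (y - z) + \<beta> / 2 * (norm (y - z))\<^sup>2 \<le> real_of_ereal (g y)"
      using ab True by (auto simp: alpha_subgradient_def)
    moreover have "h z + inner (gh z) (y - z) \<le> h y" by (rule convex_gradient_inequality[OF h_grad h_convex])
    moreover have "inner a (y - z) + inner b (y - z) + inner (gh z) (y - z) = 0"
      using ab(3) by (simp flip: inner_add_left)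
    moreover have "0 \<le> (\<alpha> + \<beta>) / 2 * (norm (y - z))\<^sup>2" using \<alpha>\<beta> by simp
    moreover have "(\<alpha> + \<beta>) / 2 * (norm (y - z))\<^sup>2 = \<alpha> / 2 * (norm (y - z))\<^sup>2 + \<beta> / 2 * (norm (y - z))\<^sup>2"
      by (simp add: distrib_right add_divide_distrib)
    ultimately have "real_of_ereal (f z) + real_of_ereal (g z) + h z
        \<le> real_of_ereal (f y) + real_of_ereal (g y) + h y" by linarith
    then show ?thesis by (subst zf, subst zg, subst yf, subst yg) simp
  next
    case False
    then have "f y + g y + ereal (h y) = \<infinity>"
      using f(1) g(1) unfolding proper_fun_def edom_def by auto
    then show ?thesis by (simp only: ereal_less_eq(1))
  qed
  then show "z \<in> argmin_fun (\<lambda>y. f y + g y + ereal (h y))" by (simp add: argmin_fun_def)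
qed

lemma p_lipschitz: "norm (p y - p z) \<le> norm (y - z) / (1 + \<gamma> * \<alpha>)"
  by (rule prox_lipschitz[OF subgradient_prox_f subgradient_prox_f \<gamma> \<gamma>\<alpha>])

lemma Prox_g_lipschitz: "norm (Prox \<delta> g y - Prox \<delta> g z) \<le> norm (y - z) / (1 + \<delta> * \<beta>)"
  by (rule prox_lipschitz[OF subgradient_prox_g subgradient_prox_g \<delta> \<delta>\<beta>])

section \<open>Limits of p and gh along bounded sequences on which p - q tends to 0\<close>

context
  fixes x :: "nat \<Rightarrow> 'a" and xs :: 'a and B :: real
  assumes bnd: "\<And>n. norm (x n - xs) \<le> B"
    and fixed: "p xs = q xs"
    and gap: "(\<lambda>n. p (x n) - q (x n)) \<longlonglongrightarrow> 0"
begin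

lemma p_bounded: "norm (p (x n) - p xs) \<le> B / (1 + \<gamma> * \<alpha>)"
  using p_lipschitz[of "x n" xs] divide_right_mono[OF bnd] \<gamma>\<alpha> by (meson less_imp_le order_trans)

lemma gh_bounded: "norm (gh (p (x n)) - gh (p xs)) \<le> 1 / \<sigma> * (B / (1 + \<gamma> * \<alpha>))"
proof -
  have "norm (gh (p (x n)) - gh (p xs)) \<le> 1 / \<sigma> * norm (p (x n) - p xs)"
    using lipschitz_onD[OF gh_lip] by (simp add: dist_norm)
  also have "\<dots> \<le> 1 / \<sigma> * (B / (1 + \<gamma> * \<alpha>))" using p_bounded \<sigma> by (intro mult_left_mono) auto
  finally show ?thesis .
qed

text \<open>Comparing \<open>x n\<close> with \<open>xs\<close>, where p = q, makes \<open>D\<close>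
  equal to the gap at \<open>x n\<close>. Every term containing it is a bounded factor times a null
  sequence, so the two remaining squares are squeezed to 0.\<close>

lemma strong_limits:
  "(\<lambda>n. gh (p (x n))) \<longlonglongrightarrow> gh (p xs)"
  "\<alpha> + \<beta> > 0 \<Longrightarrow> (\<lambda>n. p (x n)) \<longlonglongrightarrow> p xs"
proof -
  let ?P = "\<lambda>n. p (x n) - p xs" and ?C = "\<lambda>n. gh (p (x n)) - gh (p xs)" and ?d = "\<lambda>n. p (x n) - q (x n)"
  let ?R = "\<lambda>n. inner (x n - xs) (?d n) - (1 - \<gamma> / \<delta> - 2 * \<beta> * \<gamma>) * inner (?P n) (?d n)
      - \<gamma> * (1 / \<delta> + \<beta>) * (norm (?d n))\<^sup>2 + \<gamma> * inner (?C n) (?d n)"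
  have "?R \<longlonglongrightarrow> 0 - (1 - \<gamma> / \<delta> - 2 * \<beta> * \<gamma>) * 0 - \<gamma> * (1 / \<delta> + \<beta>) * 0\<^sup>2 + \<gamma> * 0"
    by (intro tendsto_intros tendsto_norm_zero inner_bounded_null_tendsto[OF bnd]
        inner_bounded_null_tendsto[OF p_bounded] inner_bounded_null_tendsto[OF gh_bounded] gap)
  then have R: "?R \<longlonglongrightarrow> 0" by simp
  have le: "\<gamma> * (\<alpha> + \<beta>) * (norm (?P n))\<^sup>2 + \<gamma> * \<sigma> * (norm (?C n))\<^sup>2 \<le> ?R n" for n
    using splitting_estimate[of "x n" xs] fixed by simp
  have null: "w \<longlonglongrightarrow> 0" if "k > 0" "\<And>n. k * (norm (w n))\<^sup>2 \<le> ?R n" for k :: real and w :: "nat \<Rightarrow> 'a"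
  proof -
    have "(\<lambda>n. (norm (w n))\<^sup>2) \<longlonglongrightarrow> 0"
    proof (rule tendsto_sandwich[of "\<lambda>_. 0" _ _ "\<lambda>n. ?R n / k"])
      show "(\<lambda>n. ?R n / k) \<longlonglongrightarrow> 0" using tendsto_divide[OF R tendsto_const[of k]] \<open>k > 0\<close> by simp
      show "eventually (\<lambda>n. (norm (w n))\<^sup>2 \<le> ?R n / k) sequentially"
        using that by (intro always_eventually allI) (simp add: pos_le_divide_eq mult.commute)
    qed auto
    then have "(\<lambda>n. sqrt ((norm (w n))\<^sup>2)) \<longlonglongrightarrow> sqrt 0" by (rule tendsto_real_sqrt)
    then show ?thesis by (simp add: tendsto_norm_zero_iff)
  qed
  have "?C \<longlonglongrightarrow> 0"
  proof (rule null)
    show "\<gamma> * \<sigma> > 0" using \<gamma> \<sigma> by simp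
    show "\<gamma> * \<sigma> * (norm (?C n))\<^sup>2 \<le> ?R n" for n
    proof -
      have "0 \<le> \<gamma> * (\<alpha> + \<beta>) * (norm (?P n))\<^sup>2" using \<gamma> \<alpha>\<beta> by simp
      then show ?thesis using le[of n] by linarith
    qed
  qed
  then show "(\<lambda>n. gh (p (x n))) \<longlonglongrightarrow> gh (p xs)" by (simp add: LIM_zero_iff)
  assume pos: "\<alpha> + \<beta> > 0"
  have "?P \<longlonglongrightarrow> 0"
  proof (rule null)
    show "\<gamma> * (\<alpha> + \<beta>) > 0" using \<gamma> pos by simp
    show "\<gamma> * (\<alpha> + \<beta>) * (norm (?P n))\<^sup>2 \<le> ?R n" for n
    proof -
      have "0 \<le> \<gamma> * \<sigma> * (norm (?C n))\<^sup>2" using \<gamma> \<sigma> by simp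
      then show ?thesis using le[of n] by linarith
    qed
  qed
  then show "(\<lambda>n. p (x n)) \<longlonglongrightarrow> p xs" by (simp add: LIM_zero_iff)
qed

text \<open>Test the monotonicity inequality of g at the prox of the limit argument perturbed by \<tau> t, keeping
  the fixed point for f. The term linear in the iterates is of order \<tau> and the constant term of
  order \<tau> squared, so a small \<tau> bounds the upper limit of the inner products with t.\<close>
lemma weak_limit_p:
  assumes ab: "\<alpha> + \<beta> = 0" and \<delta>_eq: "1 / \<delta> = 1 / \<gamma> + 2 * \<alpha>"
    and weak: "weakly_converges x xs"
  shows "weakly_converges (\<lambda>n. p (x n)) (p xs)"
proof -
  let ?P = "\<lambda>n. p (x n) - p xs" and ?K = "\<lambda>n. gh (p (x n)) - gh (p xs)" and ?d = "\<lambda>n. p (x n) - q (x n)"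
  let ?W = "\<lambda>n. x n - xs"
  have K0: "?K \<longlonglongrightarrow> 0" using strong_limits(1) by (simp add: LIM_zero_iff)
  have \<beta>: "\<beta> = - \<alpha>" using ab by simp
  obtain BD where BD: "\<And>n. norm (?d n) \<le> BD"
    using convergent_imp_Bseq[OF convergentI[OF gap]] by (auto simp: Bseq_def)
  have upper: "eventually (\<lambda>n. inner (?P n) t < \<epsilon>) sequentially" if \<epsilon>: "\<epsilon> > 0" for t \<epsilon>
  proof -
    define L where "L = norm t / (1 + \<delta> * \<beta>)"
    define M where "M = norm t * L / \<delta> + \<bar>\<alpha>\<bar> * L\<^sup>2"
    have L0: "L \<ge> 0" using \<delta>\<beta> by (simp add: L_def)
    have M0: "M \<ge> 0" using L0 \<delta> by (simp add: M_def)
    \<comment> \<open>\<open>\<tau> * L\<close> bounds the displacement of the prox and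
      \<open>\<tau>\<^sup>2 * M\<close> the second-order remainder. This \<tau> keeps the remainder
      below half of \<open>\<tau> / \<delta> * \<epsilon>\<close>; \<open>M + 1\<close> keeps the
      denominator positive when M = 0.\<close>
    define \<tau> where "\<tau> = \<epsilon> / (2 * \<delta> * (M + 1))"
    have \<tau>: "\<tau> > 0" using \<epsilon> \<delta> M0 by (simp add: \<tau>_def)
    define s where "s = p xs + \<delta> *\<^sub>R v xs"
    have s: "Prox \<delta> g s = p xs"
      by (rule Prox_eqI_g) (use subgradient_q[of xs] fixed \<delta> in \<open>simp add: s_def\<close>)
    define b where "b = Prox \<delta> g (s + \<tau> *\<^sub>R t)"
    define b' where "b' = (1 / \<delta>) *\<^sub>R (s + \<tau> *\<^sub>R t - b)"
    define E where "E = b - p xs"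
    define E' where "E' = b' - v xs"
    have sub_b: "alpha_subgradient \<beta> g b b'" unfolding b_def b'_def by (rule subgradient_prox_g)
    have nE: "norm E \<le> \<tau> * L"
      using Prox_g_lipschitz[of "s + \<tau> *\<^sub>R t" s] \<tau> by (simp add: s b_def E_def L_def)
    have E': "E' = (1 / \<delta>) *\<^sub>R (\<tau> *\<^sub>R t - E)"
      using \<delta> by (simp add: E'_def b'_def E_def s_def algebra_simps)
    have const: "inner E' E + \<alpha> * (norm E)\<^sup>2 \<le> \<tau>\<^sup>2 * M"
    proof -
      have "inner E' E = \<tau> / \<delta> * inner t E - 1 / \<delta> * (norm E)\<^sup>2"
        unfolding E' power2_norm_eq_inner by (simp add: inner_diff_left diff_divide_distrib)
      moreover have "0 \<le> 1 / \<delta> * (norm E)\<^sup>2" using \<delta> by simp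
      moreover have "inner t E \<le> norm t * (\<tau> * L)"
        using norm_cauchy_schwarz[of t E] mult_left_mono[OF nE norm_ge_zero[of t]] by linarith
      then have "\<tau> / \<delta> * inner t E \<le> \<tau> / \<delta> * (norm t * (\<tau> * L))"
        using \<tau> \<delta> by (intro mult_left_mono) auto
      moreover have "\<alpha> * (norm E)\<^sup>2 \<le> \<bar>\<alpha>\<bar> * (\<tau> * L)\<^sup>2" using nE by (intro mult_mono power_mono) auto
      moreover have "\<tau> / \<delta> * (norm t * (\<tau> * L)) + \<bar>\<alpha>\<bar> * (\<tau> * L)\<^sup>2 = \<tau>\<^sup>2 * M"
        by (simp add: M_def power2_eq_square algebra_simps)
      ultimately show ?thesis by linarith
    qed
    let ?A = "\<lambda>n. (1 / \<gamma>) *\<^sub>R (?W n - ?P n) + E' - (2 * \<alpha>) *\<^sub>R ?P n + (2 * \<alpha>) *\<^sub>R E + \<alpha> *\<^sub>R ?d n"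
    let ?R = "\<lambda>n. inner (?A n) (?d n) + inner (?P n - ?d n - E) ((1 / \<delta>) *\<^sub>R ?d n - ?K n) + 1 / \<gamma> * inner (?W n) E"
    have test: "\<tau> / \<delta> * inner (?P n) t \<le> ?R n + \<tau>\<^sup>2 * M" for n
    proof -
      have "\<alpha> * (norm (?P n))\<^sup>2 \<le> inner ((1 / \<gamma>) *\<^sub>R (?W n - ?P n)) (?P n)"
      proof -
        have "(1 / \<gamma>) *\<^sub>R (?W n - ?P n) = u (x n) - u xs" by (simp add: algebra_simps)
        then show ?thesis
          using alpha_subgradient_monotone[OF subgradient_prox_f[of "x n"] subgradient_prox_f[of xs]] by simp
      qed
      moreover have "- \<alpha> * (norm (?P n - ?d n - E))\<^sup>2
          \<le> inner ((1 / \<gamma> + 2 * \<alpha>) *\<^sub>R ?d n - (1 / \<gamma>) *\<^sub>R (?W n - ?P n) - ?K n - E') (?P n - ?d n - E)"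
      proof -
        have e1: "?P n - ?d n - E = q (x n) - b" by (simp add: E_def)
        have e2: "(1 / \<gamma> + 2 * \<alpha>) *\<^sub>R ?d n - (1 / \<gamma>) *\<^sub>R (?W n - ?P n) - ?K n - E' = v (x n) - b'"
          unfolding E'_def \<delta>_eq[symmetric] fixed[symmetric] by (simp add: algebra_simps)
        show ?thesis unfolding e1 e2
          using alpha_subgradient_monotone[OF subgradient_q[of "x n"] sub_b] unfolding \<beta> .
      qed
      ultimately have "inner (?P n) ((1 / \<gamma> + 2 * \<alpha>) *\<^sub>R E + E') \<le>
          inner (?A n) (?d n) + inner (?P n - ?d n - E) ((1 / \<gamma> + 2 * \<alpha>) *\<^sub>R ?d n - ?K n)
          + 1 / \<gamma> * inner (?W n) E + inner E' E + \<alpha> * (norm E)\<^sup>2"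
        by (rule weak_test_inequality)
      \<comment> \<open>The displacement \<open>E\<close> has no explicit form, but this combination
        does: perturbing the argument of the prox, not its value, makes the products with the chosen
        direction t appear.\<close>
      moreover have "(1 / \<delta>) *\<^sub>R E + E' = (\<tau> / \<delta>) *\<^sub>R t" unfolding E' by (simp add: algebra_simps)
      ultimately show ?thesis using const unfolding \<delta>_eq[symmetric] by simp
    qed
    have A_bnd: "norm (?A n) \<le> 1 / \<gamma> * (B + B / (1 + \<gamma> * \<alpha>)) + norm E' + 2 * \<bar>\<alpha>\<bar> * (B / (1 + \<gamma> * \<alpha>))
        + 2 * \<bar>\<alpha>\<bar> * norm E + \<bar>\<alpha>\<bar> * BD" for n
    proof -
      have "norm (?W n - ?P n) \<le> B + B / (1 + \<gamma> * \<alpha>)"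
        using norm_triangle_ineq4[of "?W n" "?P n"] bnd[of n] p_bounded[of n] by linarith
      then have "norm ((1 / \<gamma>) *\<^sub>R (?W n - ?P n)) \<le> 1 / \<gamma> * (B + B / (1 + \<gamma> * \<alpha>))"
        using \<gamma> by (simp add: divide_right_mono)
      moreover have "norm ((2 * \<alpha>) *\<^sub>R ?P n) \<le> 2 * \<bar>\<alpha>\<bar> * (B / (1 + \<gamma> * \<alpha>))"
        unfolding norm_scaleR using p_bounded[of n] by (intro mult_mono) auto
      moreover have "norm (\<alpha> *\<^sub>R ?d n) \<le> \<bar>\<alpha>\<bar> * BD"
        unfolding norm_scaleR using BD[of n] by (intro mult_mono) auto
      ultimately show ?thesis
        by (intro norm_triangle_le add_mono order_trans[OF norm_triangle_ineq4]) auto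
    qed
    have B_bnd: "norm (?P n - ?d n - E) \<le> B / (1 + \<gamma> * \<alpha>) + BD + norm E" for n
      using p_bounded[of n] BD[of n] norm_triangle_ineq4[of "?P n" "?d n"]
        norm_triangle_ineq4[of "?P n - ?d n" E] by linarith
    have d1: "(\<lambda>n. (1 / \<delta>) *\<^sub>R ?d n - ?K n) \<longlonglongrightarrow> 0"
      using tendsto_diff[OF tendsto_scaleR[OF tendsto_const[of "1 / \<delta>"] gap] K0] by simp
    have "(\<lambda>n. inner (x n) E - inner xs E) \<longlonglongrightarrow> 0"
      using weak by (simp add: weakly_converges_def LIM_zero_iff)
    then have w1: "(\<lambda>n. inner (?W n) E) \<longlonglongrightarrow> 0" by (simp add: inner_diff_left)
    have "?R \<longlonglongrightarrow> 0 + 0 + 1 / \<gamma> * 0"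
      by (intro tendsto_intros inner_bounded_null_tendsto[OF A_bnd gap]
          inner_bounded_null_tendsto[OF B_bnd d1] w1)
    then have R: "?R \<longlonglongrightarrow> 0" by simp
    have "\<tau> * M < \<tau> * (M + 1)" using \<tau> by simp
    then have "\<tau>\<^sup>2 * M < \<tau> * (\<tau> * (M + 1))" using \<tau> by (simp add: power2_eq_square)
    also have "\<tau> * (M + 1) = \<epsilon> / (2 * \<delta>)" using M0 by (simp add: \<tau>_def)
    finally have M_small: "\<tau>\<^sup>2 * M < \<tau> / \<delta> * \<epsilon> / 2" by (simp add: mult.commute)
    have "\<tau> / \<delta> * \<epsilon> / 2 > 0" using \<tau> \<delta> \<epsilon> by simp
    from order_tendstoD(2)[OF R this]
    show ?thesis
    proof eventually_elim
      case (elim n)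
      have "\<tau> / \<delta> * inner (?P n) t < \<tau> / \<delta> * \<epsilon>" using elim test[of n] M_small by linarith
      then show ?case using \<tau> \<delta> by (simp add: divide_less_cancel)
    qed
  qed
  have "(\<lambda>n. inner (p (x n)) t) \<longlonglongrightarrow> inner (p xs) t" for t
  proof (rule tendstoI)
    fix e :: real assume e: "e > 0"
    show "eventually (\<lambda>n. dist (inner (p (x n)) t) (inner (p xs) t) < e) sequentially"
      using upper[OF e, of t] upper[OF e, of "- t"]
      by eventually_elim (simp add: dist_real_def inner_diff_left abs_less_iff)
  qed
  then show ?thesis by (simp add: weakly_converges_def)
qed

end

end

section \<open>Step size conditions\<close>

lemma complete_square_lower_bound:
  fixes P D :: "'a::real_inner"
  assumes "a > 0"
  shows "- (k\<^sup>2 / (4 * a)) * (norm D)\<^sup>2 \<le> a * (norm P)\<^sup>2 + k * inner P D"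
proof -
  have "0 \<le> (norm ((2 * a) *\<^sub>R P + k *\<^sub>R D))\<^sup>2" by simp
  also have "\<dots> = 4 * a * (a * (norm P)\<^sup>2 + k * inner P D) + k\<^sup>2 * (norm D)\<^sup>2"
    unfolding power2_norm_eq_inner
    by (simp add: inner_add_left inner_add_right inner_commute power2_eq_square algebra_simps)
  finally have "- (k\<^sup>2 * (norm D)\<^sup>2) \<le> (a * (norm P)\<^sup>2 + k * inner P D) * (4 * a)"
    by (simp add: mult.commute)
  then have "- (k\<^sup>2 * (norm D)\<^sup>2) / (4 * a) \<le> a * (norm P)\<^sup>2 + k * inner P D"
    using assms by (subst pos_divide_le_eq) simp_all
  then show ?thesis by simp
qed

lemma norm_diff_scaleR_power2:
  fixes w d :: "'a::real_inner"
  shows "(norm (w - t *\<^sub>R d))\<^sup>2 = (norm w)\<^sup>2 - t * (2 * inner w d) + t\<^sup>2 * (norm d)\<^sup>2"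
  unfolding power2_norm_eq_inner
  by (simp add: inner_diff_left inner_diff_right inner_commute power2_eq_square algebra_simps)

definition admissible_parameters :: "real \<Rightarrow> real \<Rightarrow> real \<Rightarrow> real \<Rightarrow> real \<Rightarrow> real \<Rightarrow> bool" where
  "admissible_parameters \<alpha> \<beta> \<sigma> \<gamma> \<delta> \<eta>s \<longleftrightarrow>
     (\<alpha> + \<beta> = 0 \<and> 1 + 2 * \<gamma> * \<alpha> > 0 \<and> \<delta> = \<gamma> / (1 + 2 * \<gamma> * \<alpha>)
          \<and> \<eta>s = 2 + 2 * \<gamma> * \<alpha> - \<gamma> / (2 * \<sigma>) \<and> \<eta>s > 0)
       \<or> (\<alpha> + \<beta> > 0
          \<and> \<eta>s = (4 * \<gamma> * \<delta> * (1 + \<gamma> * \<alpha>) * (1 + \<delta> * \<beta>) - (\<gamma> + \<delta>)\<^sup>2)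
                   / (2 * \<gamma> * \<delta>\<^sup>2 * (\<alpha> + \<beta>)) - \<gamma> / (2 * \<sigma>)
          \<and> \<eta>s > 0)"

context
  fixes \<alpha> \<beta> \<sigma> \<gamma> \<delta> \<eta>s :: real
  assumes adm: "admissible_parameters \<alpha> \<beta> \<sigma> \<gamma> \<delta> \<eta>s"
    and \<sigma>: "\<sigma> > 0" and \<gamma>: "\<gamma> > 0" and \<delta>: "\<delta> > 0"
begin

text \<open>If \<alpha> + \<beta> = 0, the formula for \<delta> gives \<open>(1 + 2 * \<gamma> *
  \<alpha>) * (1 + \<delta> * \<beta>) = 1 + \<gamma> * \<alpha>\<close>, the mean of 1 and
  \<open>1 + 2 * \<gamma> * \<alpha>\<close>. Otherwise \<eta>s > 0 makes the product of the two
  factors positive, and both being negative would force \<alpha>, \<beta> < 0.\<close>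

lemma admissible_step_sizes: "1 + \<gamma> * \<alpha> > 0" "1 + \<delta> * \<beta> > 0" "\<alpha> + \<beta> \<ge> 0" "\<eta>s > 0"
proof -
  consider (a) "\<alpha> + \<beta> = 0" "1 + 2 * \<gamma> * \<alpha> > 0" "\<delta> = \<gamma> / (1 + 2 * \<gamma> * \<alpha>)"
    | (b) "\<alpha> + \<beta> > 0" "(4 * \<gamma> * \<delta> * (1 + \<gamma> * \<alpha>) * (1 + \<delta> * \<beta>) - (\<gamma> + \<delta>)\<^sup>2)
                   / (2 * \<gamma> * \<delta>\<^sup>2 * (\<alpha> + \<beta>)) > \<gamma> / (2 * \<sigma>)"
    using adm by (auto simp: admissible_parameters_def)
  then have "1 + \<gamma> * \<alpha> > 0 \<and> 1 + \<delta> * \<beta> > 0"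
  proof cases
    case a
    have 1: "1 + \<gamma> * \<alpha> > 0" using a(2) by simp
    have "(1 + 2 * \<gamma> * \<alpha>) * (1 + \<delta> * \<beta>) = 1 + 2 * \<gamma> * \<alpha> + \<beta> * ((1 + 2 * \<gamma> * \<alpha>) * \<delta>)"
      by (simp add: algebra_simps)
    also have "(1 + 2 * \<gamma> * \<alpha>) * \<delta> = \<gamma>" using a(2,3) by simp
    also have "1 + 2 * \<gamma> * \<alpha> + \<beta> * \<gamma> = 1 + \<gamma> * \<alpha> + \<gamma> * (\<alpha> + \<beta>)" by (simp add: algebra_simps)
    finally have "(1 + 2 * \<gamma> * \<alpha>) * (1 + \<delta> * \<beta>) > 0" using a(1) 1 by simp
    then show ?thesis using a(2) 1 zero_less_mult_pos by blast
  next
    case b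
    have "0 < \<gamma> / (2 * \<sigma>)" using \<gamma> \<sigma> by simp
    then have "0 < (4 * \<gamma> * \<delta> * (1 + \<gamma> * \<alpha>) * (1 + \<delta> * \<beta>) - (\<gamma> + \<delta>)\<^sup>2) / (2 * \<gamma> * \<delta>\<^sup>2 * (\<alpha> + \<beta>))"
      using b(2) by linarith
    moreover have "2 * \<gamma> * \<delta>\<^sup>2 * (\<alpha> + \<beta>) > 0" using b(1) \<gamma> \<delta> by simp
    ultimately have "0 < 4 * \<gamma> * \<delta> * (1 + \<gamma> * \<alpha>) * (1 + \<delta> * \<beta>) - (\<gamma> + \<delta>)\<^sup>2"
      using zero_less_divide_iff order_less_asym by blast
    moreover have "0 \<le> (\<gamma> + \<delta>)\<^sup>2" by simp
    ultimately have "0 < 4 * \<gamma> * \<delta> * (1 + \<gamma> * \<alpha>) * (1 + \<delta> * \<beta>)" by linarith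
    then have "0 < 4 * \<gamma> * \<delta> * ((1 + \<gamma> * \<alpha>) * (1 + \<delta> * \<beta>))" by (simp only: mult.assoc)
    then have "0 < (1 + \<gamma> * \<alpha>) * (1 + \<delta> * \<beta>)"
      by (rule zero_less_mult_pos) (use \<gamma> \<delta> in simp)
    moreover have False if "1 + \<gamma> * \<alpha> < 0" "1 + \<delta> * \<beta> < 0"
    proof -
      have "\<gamma> * \<alpha> < 0" "\<delta> * \<beta> < 0" using that by linarith+
      then have "\<alpha> < 0" "\<beta> < 0" using \<gamma> \<delta> by (auto simp: mult_less_0_iff)
      then show False using b(1) by linarith
    qed
    ultimately show ?thesis by (auto simp: zero_less_mult_iff)
  qed
  then show "1 + \<gamma> * \<alpha> > 0" "1 + \<delta> * \<beta> > 0" by auto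
  show "\<alpha> + \<beta> \<ge> 0" "\<eta>s > 0" using adm by (auto simp: admissible_parameters_def)
qed

text \<open>The origin of \<eta>s: half of it is the coefficient of the square of \<open>D\<close>
  left after completing the squares in \<open>C\<close> and, if \<alpha> + \<beta> > 0, in
  \<open>P\<close>.\<close>

lemma cocoercivity_coefficient:
  fixes P C D :: "'a::real_inner"
  shows "\<eta>s / 2 * (norm D)\<^sup>2 \<le> (1 - \<gamma> / \<delta> - 2 * \<beta> * \<gamma>) * inner P D + \<gamma> * (\<alpha> + \<beta>) * (norm P)\<^sup>2
      + \<gamma> * (1 / \<delta> + \<beta>) * (norm D)\<^sup>2 + \<gamma> * \<sigma> * (norm C)\<^sup>2 - \<gamma> * inner C D"
proof -
  let ?k = "1 - \<gamma> / \<delta> - 2 * \<beta> * \<gamma>"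
  have "- ((- \<gamma>)\<^sup>2 / (4 * (\<gamma> * \<sigma>))) * (norm D)\<^sup>2 \<le> \<gamma> * \<sigma> * (norm C)\<^sup>2 + - \<gamma> * inner C D"
    by (rule complete_square_lower_bound) (use \<gamma> \<sigma> in simp)
  moreover have "(- \<gamma>)\<^sup>2 / (4 * (\<gamma> * \<sigma>)) = \<gamma> / (4 * \<sigma>)" using \<gamma> by (simp add: power2_eq_square)
  ultimately have C: "- (\<gamma> / (4 * \<sigma>)) * (norm D)\<^sup>2 \<le> \<gamma> * \<sigma> * (norm C)\<^sup>2 - \<gamma> * inner C D"
    by (simp only: minus_mult_left[symmetric] add_uminus_conv_diff)
  consider (a) "\<alpha> + \<beta> = 0" "1 + 2 * \<gamma> * \<alpha> > 0" "\<delta> = \<gamma> / (1 + 2 * \<gamma> * \<alpha>)"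
      "\<eta>s = 2 + 2 * \<gamma> * \<alpha> - \<gamma> / (2 * \<sigma>)"
    | (b) "\<alpha> + \<beta> > 0" "\<eta>s = (4 * \<gamma> * \<delta> * (1 + \<gamma> * \<alpha>) * (1 + \<delta> * \<beta>) - (\<gamma> + \<delta>)\<^sup>2)
                   / (2 * \<gamma> * \<delta>\<^sup>2 * (\<alpha> + \<beta>)) - \<gamma> / (2 * \<sigma>)"
    using adm by (auto simp: admissible_parameters_def)
  then have "(\<eta>s / 2 + \<gamma> / (4 * \<sigma>)) * (norm D)\<^sup>2
      \<le> \<gamma> * (1 / \<delta> + \<beta>) * (norm D)\<^sup>2 + (\<gamma> * (\<alpha> + \<beta>) * (norm P)\<^sup>2 + ?k * inner P D)"
  proof cases
    case a
    have \<beta>: "\<beta> = - \<alpha>" using a(1) by simp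
    have q: "\<gamma> / \<delta> = 1 + 2 * \<gamma> * \<alpha>" using a(3) \<gamma> by simp
    \<comment> \<open>The prescribed \<delta> is the one for which the mixed term
      disappears.\<close>
    have "?k = 0" unfolding q \<beta> by simp
    moreover have "\<gamma> * (1 / \<delta> + \<beta>) = 1 + \<gamma> * \<alpha>" using q unfolding \<beta> by (simp add: algebra_simps)
    moreover have "\<eta>s / 2 + \<gamma> / (4 * \<sigma>) = 1 + \<gamma> * \<alpha>" unfolding a(4) by (simp add: diff_divide_distrib add_divide_distrib)
    ultimately show ?thesis using a(1) by simp
  next
    case b
    define s where "s = \<alpha> + \<beta>"
    have s: "s > 0" "\<alpha> = s - \<beta>" using b(1) by (auto simp: s_def)
    have "- (?k\<^sup>2 / (4 * (\<gamma> * s))) * (norm D)\<^sup>2 \<le> \<gamma> * s * (norm P)\<^sup>2 + ?k * inner P D"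
      by (rule complete_square_lower_bound) (use \<gamma> s in simp)
    moreover have "\<eta>s / 2 + \<gamma> / (4 * \<sigma>) = \<gamma> * (1 / \<delta> + \<beta>) - ?k\<^sup>2 / (4 * (\<gamma> * s))"
    proof -
      have k: "?k = (\<delta> - \<gamma> - 2 * \<beta> * \<gamma> * \<delta>) / \<delta>" using \<delta> by (simp add: field_simps)
      have k2: "?k\<^sup>2 / (4 * (\<gamma> * s)) = (\<delta> - \<gamma> - 2 * \<beta> * \<gamma> * \<delta>)\<^sup>2 / (4 * \<gamma> * \<delta>\<^sup>2 * s)"
        unfolding k by (simp add: power_divide mult_ac)
      have l: "\<gamma> * (1 / \<delta> + \<beta>) = (4 * \<gamma>\<^sup>2 * \<delta> * s * (1 + \<delta> * \<beta>)) / (4 * \<gamma> * \<delta>\<^sup>2 * s)"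
        using \<gamma> \<delta> s(1) by (simp add: field_simps power2_eq_square)
      \<comment> \<open>Over the common denominator, the coefficient of the square of
        \<open>D\<close> minus the cost of absorbing the mixed term becomes the symmetric numerator
        in the closed form of \<eta>s.\<close>
      have num: "4 * \<gamma>\<^sup>2 * \<delta> * s * (1 + \<delta> * \<beta>) - (\<delta> - \<gamma> - 2 * \<beta> * \<gamma> * \<delta>)\<^sup>2
          = 4 * \<gamma> * \<delta> * (1 + \<gamma> * \<alpha>) * (1 + \<delta> * \<beta>) - (\<gamma> + \<delta>)\<^sup>2"
        unfolding s(2) by (simp add: power2_eq_square algebra_simps)
      have "\<eta>s / 2 + \<gamma> / (4 * \<sigma>)
          = (4 * \<gamma> * \<delta> * (1 + \<gamma> * \<alpha>) * (1 + \<delta> * \<beta>) - (\<gamma> + \<delta>)\<^sup>2) / (4 * \<gamma> * \<delta>\<^sup>2 * s)"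
        unfolding b(2) s_def[symmetric] by (simp add: diff_divide_distrib mult_ac)
      then show ?thesis unfolding k2 l num[symmetric] by (simp add: diff_divide_distrib)
    qed
    ultimately show ?thesis unfolding s_def[symmetric] by (simp add: left_diff_distrib)
  qed
  then show ?thesis using C by (simp add: distrib_right)
qed

end

section \<open>Averagedness and convergence of the splitting iteration\<close>

theorem theorem6p2:
  fixes f g :: "'a::{real_inner, complete_space} \<Rightarrow> ereal"
    and h :: "'a \<Rightarrow> real" and gh :: "'a \<Rightarrow> 'a"
    and \<alpha> \<beta> \<sigma> \<gamma> \<delta> \<eta> \<eta>s :: real
    and x :: "nat \<Rightarrow> 'a"
  assumes f: "proper_fun f" "lsc_fun f" "alpha_convex \<alpha> f"
    and g: "proper_fun g" "lsc_fun g" "alpha_convex \<beta> g"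
    and h_grad: "\<And>y. (h has_derivative (\<lambda>v. inner (gh y) v)) (at y)"
    and h_convex: "convex_on UNIV h"
    and \<sigma>: "\<sigma> > 0"
    and gh_lip: "(1 / \<sigma>)-lipschitz_on UNIV gh"
    and pos: "\<gamma> > 0" "\<delta> > 0" "\<eta> > 0"
    and cases:
      "(\<alpha> + \<beta> = 0 \<and> 1 + 2 * \<gamma> * \<alpha> > 0 \<and> \<delta> = \<gamma> / (1 + 2 * \<gamma> * \<alpha>)
          \<and> \<eta>s = 2 + 2 * \<gamma> * \<alpha> - \<gamma> / (2 * \<sigma>) \<and> \<eta>s > 0)
       \<or> (\<alpha> + \<beta> > 0
          \<and> \<eta>s = (4 * \<gamma> * \<delta> * (1 + \<gamma> * \<alpha>) * (1 + \<delta> * \<beta>) - (\<gamma> + \<delta>)\<^sup>2)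
                   / (2 * \<gamma> * \<delta>\<^sup>2 * (\<alpha> + \<beta>)) - \<gamma> / (2 * \<sigma>)
          \<and> \<eta>s > 0)"
    and iter: "\<And>n. x (Suc n) = T_op \<gamma> \<delta> \<eta> f g gh (x n)"
  shows
    "(\<forall>y. \<exists>!z. z \<in> T_set \<gamma> \<delta> \<eta> f g gh y)
     \<and> (\<forall>y. T_set \<gamma> \<delta> \<eta> f g gh y = {T_op \<gamma> \<delta> \<eta> f g gh y})
     \<and> conically_averaged (\<eta> / \<eta>s) (T_set \<gamma> \<delta> \<eta> f g gh)
     \<and> (zer_sum f g gh \<noteq> {} \<and> \<eta> < \<eta>s \<longrightarrow>
         (\<lambda>n. norm (x n - T_op \<gamma> \<delta> \<eta> f g gh (x n))) \<in> o(\<lambda>n. 1 / sqrt (real n))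
         \<and> (\<exists>xs. weakly_converges x xs
              \<and> T_op \<gamma> \<delta> \<eta> f g gh xs = xs
              \<and> Prox \<gamma> f xs \<in> zer_sum f g gh
              \<and> zer_sum f g gh \<subseteq> argmin_fun (\<lambda>y. f y + g y + ereal (h y))
              \<and> (\<lambda>n. gh (Prox \<gamma> f (x n))) \<longlonglongrightarrow> gh (Prox \<gamma> f xs)
              \<and> gh ` zer_sum f g gh = {gh (Prox \<gamma> f xs)}
              \<and> (\<alpha> + \<beta> = 0 \<longrightarrow>
                   weakly_converges (\<lambda>n. Prox \<gamma> f (x n)) (Prox \<gamma> f xs)
                   \<and> weakly_converges (\<lambda>n. Prox \<delta> g (S_op \<gamma> \<delta> f gh (x n))) (Prox \<gamma> f xs)
                   \<and> Prox \<gamma> f xs = Prox \<delta> g (S_op \<gamma> \<delta> f gh xs))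
              \<and> (\<alpha> + \<beta> > 0 \<longrightarrow>
                   (\<lambda>n. Prox \<gamma> f (x n)) \<longlonglongrightarrow> Prox \<gamma> f xs
                   \<and> (\<lambda>n. Prox \<delta> g (S_op \<gamma> \<delta> f gh (x n))) \<longlonglongrightarrow> Prox \<gamma> f xs
                   \<and> Prox \<gamma> f xs = Prox \<delta> g (S_op \<gamma> \<delta> f gh xs)
                   \<and> zer_sum f g gh = {Prox \<gamma> f xs})))"
proof -
  have adm: "admissible_parameters \<alpha> \<beta> \<sigma> \<gamma> \<delta> \<eta>s"
    using cases by (simp only: admissible_parameters_def)
  note params = admissible_step_sizes[OF adm \<sigma> pos(1,2)]
  interpret three_operator_splitting f g h gh \<alpha> \<beta> \<sigma> \<gamma> \<delta>
    by unfold_locales (fact f g h_grad h_convex \<sigma> gh_lip pos params)+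
  let ?T = "T_op \<gamma> \<delta> \<eta> f g gh"
  let ?D = "\<lambda>y z. (p y - q y) - (p z - q z)"
  have T: "?T y = y - \<eta> *\<^sub>R (p y - q y)" for y by (simp add: T_op_def algebra_simps)
  have coco: "\<eta>s * (norm (?D y z))\<^sup>2 \<le> 2 * inner (y - z) (?D y z)" for y z
    using order_trans[OF cocoercivity_coefficient[OF adm \<sigma> pos(1,2)] splitting_estimate[of y z]] by simp
  \<comment> \<open>Used for two step lengths: t = \<eta>s gives the nonexpansive map behind
    averagedness, t = \<eta> the decrease along the iterates.\<close>
  have relaxed: "(norm (y - z - t *\<^sub>R ?D y z))\<^sup>2 + t * (\<eta>s - t) * (norm (?D y z))\<^sup>2 \<le> (norm (y - z))\<^sup>2"
    if "t > 0" for t y z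
  proof -
    have "(norm (y - z - t *\<^sub>R ?D y z))\<^sup>2
        = (norm (y - z))\<^sup>2 - t * (2 * inner (y - z) (?D y z)) + t\<^sup>2 * (norm (?D y z))\<^sup>2"
      by (rule norm_diff_scaleR_power2)
    moreover have "t * (\<eta>s * (norm (?D y z))\<^sup>2) \<le> t * (2 * inner (y - z) (?D y z))"
      using coco[of y z] that by (intro mult_left_mono) auto
    moreover have "t * (\<eta>s - t) * (norm (?D y z))\<^sup>2 = t * (\<eta>s * (norm (?D y z))\<^sup>2) - t\<^sup>2 * (norm (?D y z))\<^sup>2"
      by (simp add: power2_eq_square left_diff_distrib right_diff_distrib mult.assoc)
    ultimately show ?thesis by linarith
  qed
  \<comment> \<open>The longest step that \<open>relaxed\<close> shows to be nonexpansive; T moves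
    the fraction \<eta>/\<eta>s of it, possibly more than the whole.\<close>
  have "nonexpansive (\<lambda>y. y - \<eta>s *\<^sub>R (p y - q y))"
    unfolding nonexpansive_def
  proof (intro allI)
    fix y z
    have "(norm (y - z - \<eta>s *\<^sub>R ?D y z))\<^sup>2 \<le> (norm (y - z))\<^sup>2" using relaxed[OF params(4), of y z] by simp
    then have "norm (y - z - \<eta>s *\<^sub>R ?D y z) \<le> norm (y - z)" by (rule power2_le_imp_le) simp
    moreover have "y - \<eta>s *\<^sub>R (p y - q y) - (z - \<eta>s *\<^sub>R (p z - q z)) = y - z - \<eta>s *\<^sub>R ?D y z"
      by (simp add: scaleR_right_diff_distrib)
    ultimately show "norm (y - \<eta>s *\<^sub>R (p y - q y) - (z - \<eta>s *\<^sub>R (p z - q z))) \<le> norm (y - z)" by (simp only:)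
  qed
  moreover have "T_set \<gamma> \<delta> \<eta> f g gh y = {(1 - \<eta> / \<eta>s) *\<^sub>R y + (\<eta> / \<eta>s) *\<^sub>R (y - \<eta>s *\<^sub>R (p y - q y))}" for y
    using params(4) by (simp add: T_set_eq T algebra_simps)
  ultimately have averaged: "conically_averaged (\<eta> / \<eta>s) (T_set \<gamma> \<delta> \<eta> f g gh)"
    unfolding conically_averaged_def using pos(3) params(4) by (intro conjI exI[of _ "\<lambda>y. y - \<eta>s *\<^sub>R (p y - q y)"]) auto
  let ?goal = "(\<lambda>n. norm (x n - ?T (x n))) \<in> o(\<lambda>n. 1 / sqrt (real n))
         \<and> (\<exists>xs. weakly_converges x xs
              \<and> ?T xs = xs
              \<and> p xs \<in> zer_sum f g gh
              \<and> zer_sum f g gh \<subseteq> argmin_fun (\<lambda>y. f y + g y + ereal (h y))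
              \<and> (\<lambda>n. gh (p (x n))) \<longlonglongrightarrow> gh (p xs)
              \<and> gh ` zer_sum f g gh = {gh (p xs)}
              \<and> (\<alpha> + \<beta> = 0 \<longrightarrow>
                   weakly_converges (\<lambda>n. p (x n)) (p xs)
                   \<and> weakly_converges (\<lambda>n. q (x n)) (p xs)
                   \<and> p xs = q xs)
              \<and> (\<alpha> + \<beta> > 0 \<longrightarrow>
                   (\<lambda>n. p (x n)) \<longlonglongrightarrow> p xs
                   \<and> (\<lambda>n. q (x n)) \<longlonglongrightarrow> p xs
                   \<and> p xs = q xs
                   \<and> zer_sum f g gh = {p xs}))"
  have ?goal if zer: "zer_sum f g gh \<noteq> {}" and \<eta>: "\<eta> < \<eta>s"
  proof -
    have contr: "(norm (?T y - ?T z))\<^sup>2 + \<eta> * (\<eta>s - \<eta>) * (norm (?D y z))\<^sup>2 \<le> (norm (y - z))\<^sup>2" for y z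
    proof -
      have "?T y - ?T z = y - z - \<eta> *\<^sub>R ?D y z" unfolding T by (simp add: scaleR_right_diff_distrib)
      then show ?thesis using relaxed[OF pos(3)] by simp
    qed
    have slack: "0 \<le> \<eta> * (\<eta>s - \<eta>)" using pos(3) \<eta> by simp
    have nonexp: "nonexpansive ?T"
      unfolding nonexpansive_def
    proof (intro allI)
      fix y z
      have "0 \<le> \<eta> * (\<eta>s - \<eta>) * (norm (?D y z))\<^sup>2" using slack by simp
      then have "(norm (?T y - ?T z))\<^sup>2 \<le> (norm (y - z))\<^sup>2" using contr[of y z] by linarith
      then show "norm (?T y - ?T z) \<le> norm (y - z)" by (rule power2_le_imp_le) simp
    qed
    have fix_iff: "?T y = y \<longleftrightarrow> p y = q y" for y using pos(3) by (simp add: T)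
    obtain z where z: "p z = q z" using zer zer_sum_iff by (metis ex_in_conv)
    have Tz: "?T z = z" using z fix_iff by simp
    \<comment> \<open>Against a fixed point, \<open>?D y z\<close> is (y - T y)/\<eta>, so the gain
      \<eta> (\<eta>s - \<eta>) is divided by the square of \<eta>.\<close>
    have k: "(\<eta>s - \<eta>) / \<eta> > 0" using \<eta> pos(3) by simp
    have avg: "(norm (?T y - z))\<^sup>2 + (\<eta>s - \<eta>) / \<eta> * (norm (y - ?T y))\<^sup>2 \<le> (norm (y - z))\<^sup>2" for y
    proof -
      have "(\<eta>s - \<eta>) / \<eta> * (norm (y - ?T y))\<^sup>2 = \<eta> * (\<eta>s - \<eta>) * (norm (?D y z))\<^sup>2"
        using pos(3) z by (simp add: T power_mult_distrib power2_eq_square)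
      then show ?thesis using contr[of y z] Tz by simp
    qed
    note regular = averaged_iterates_asymptotically_regular[where x = x, OF nonexp iter k avg]
    obtain xs where xs: "weakly_converges x xs" "?T xs = xs"
      using nonexpansive_iterates_weakly_converge[where x = x, OF nonexp iter Tz regular(2)] by blast
    have fixed: "p xs = q xs" using xs(2) fix_iff by simp
    have bnd: "norm (x n - xs) \<le> norm (x 0 - xs)" for n
    proof (induction n)
      case (Suc n)
      have "norm (x (Suc n) - xs) \<le> norm (x n - xs)"
        using nonexp xs(2) unfolding nonexpansive_def iter by metis
      then show ?case using Suc by simp
    qed simp
    have gap: "(\<lambda>n. p (x n) - q (x n)) \<longlonglongrightarrow> 0"
    proof -
      have "(\<lambda>n. norm (x n - ?T (x n)) / \<eta>) \<longlonglongrightarrow> 0" using tendsto_divide_zero[OF regular(2)] .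
      moreover have "norm (x n - ?T (x n)) / \<eta> = norm (p (x n) - q (x n))" for n
        using pos(3) by (simp add: T)
      ultimately show ?thesis by (simp add: tendsto_norm_zero_iff)
    qed
    note strong = strong_limits[where x = x, OF bnd fixed gap]
    have zp: "p xs \<in> zer_sum f g gh" using zer_sum_iff fixed by metis
    have gh_zer: "gh ` zer_sum f g gh = {gh (p xs)}"
    proof (rule antisym[OF image_subsetI])
      fix w assume w: "w \<in> zer_sum f g gh"
      show "gh w \<in> {gh (p xs)}"
      proof -
        obtain y where "p y = w" "q y = w" using w zer_sum_iff[of w] by blast
        then show ?thesis using coincidence_unique(1)[of y xs] fixed by simp
      qed
    qed (simp add: imageI[OF zp])
    have A: "weakly_converges (\<lambda>n. p (x n)) (p xs) \<and> weakly_converges (\<lambda>n. q (x n)) (p xs) \<and> p xs = q xs"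
      if ab: "\<alpha> + \<beta> = 0"
    proof -
      have "1 + 2 * \<gamma> * \<alpha> > 0" "\<delta> = \<gamma> / (1 + 2 * \<gamma> * \<alpha>)" using cases ab by auto
      then have "1 / \<delta> = 1 / \<gamma> + 2 * \<alpha>" using pos(1) by (simp add: add_divide_distrib)
      then have wp: "weakly_converges (\<lambda>n. p (x n)) (p xs)"
        using weak_limit_p[where x = x, OF bnd fixed gap ab] xs(1) by blast
      \<comment> \<open>q differs from p by the strongly null gap, so it inherits the weak
        limit.\<close>
      have "(\<lambda>n. inner (q (x n)) y) \<longlonglongrightarrow> inner (p xs) y" for y
      proof -
        have "(\<lambda>n. inner (p (x n)) y - inner (p (x n) - q (x n)) y) \<longlonglongrightarrow> inner (p xs) y - inner 0 y"
          by (intro tendsto_diff wp[unfolded weakly_converges_def, rule_format] tendsto_inner gap tendsto_const)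
        then show ?thesis by (simp add: inner_diff_left)
      qed
      then show ?thesis using wp fixed by (simp add: weakly_converges_def)
    qed
    have B: "(\<lambda>n. p (x n)) \<longlonglongrightarrow> p xs \<and> (\<lambda>n. q (x n)) \<longlonglongrightarrow> p xs \<and> p xs = q xs
        \<and> zer_sum f g gh = {p xs}" if ab: "\<alpha> + \<beta> > 0"
    proof -
      have "(\<lambda>n. p (x n) - (p (x n) - q (x n))) \<longlonglongrightarrow> p xs - 0"
        by (intro tendsto_diff strong(2)[OF ab] gap)
      then have qlim: "(\<lambda>n. q (x n)) \<longlonglongrightarrow> p xs" by simp
      have "zer_sum f g gh \<subseteq> {p xs}"
      proof
        fix w assume w: "w \<in> zer_sum f g gh"
        obtain y where "p y = w" "q y = w" using w zer_sum_iff[of w] by blast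
        then show "w \<in> {p xs}" using coincidence_unique(2)[of y xs] fixed ab by simp
      qed
      then have "zer_sum f g gh = {p xs}" using zp by blast
      then show ?thesis using strong(2)[OF ab] qlim fixed by blast
    qed
    show ?thesis
      using regular(1) xs zp zer_sum_subset_argmin strong(1) gh_zer A B by blast
  qed
  then show ?thesis using T_set_eq averaged by simp
qed

end
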